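(* Let $a,b\in\mathbb{R}[\sin t,\cos t]$ be real trigonometric polynomials (so $2\pi$-periodic), and assume that $b$ has only simple zeroes. Consider the scalar piecewise linear equation \[ x'=a(t)|x|+b(t), \] and for $x\in\mathbb{R}$ let $u(t,x)$ denote its solution with $u(0,x)=x$. Assume the following hypothesis: there exists an open interval $(x_1,x_2)$ such that for every $x\in(x_1,x_2)$ the function $t\mapsto u(t,x)$ has exactly two zeroes $t_1(x)<t_2(x)$ in $(0,2\pi)$, both simple, and such that \[ \lim_{x\to x_1^+}\big(t_2(x)-t_1(x)\big)=0\quad\text{or}\quad\lim_{x\to x_2^-}\big(t_2(x)-t_1(x)\big)=0. \] Then the equation has a global center (every solution is $2\pi$-periodic, i.e. $u(2\pi,x)=u(0,x)$ for all $x\in\mathbb{R}$) if and only if there exist polynomials $P,Q\in\mathbb{R}[x]$ and a trigonometric polynomial $h\in\mathbb{R}[\sin t,\cos t]$ such that \[ a(t)=P(h(t))\,h'(t),\qquad b(t)=Q(h(t))\,h'(t)\quad\text{for all } t. \]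
   Context: A solution $x(t)$ is called periodic if $x(0)=x(2\pi)$. A periodic solution is a center if it is not isolated in the set of periodic solutions, and the equation has a global center if every solution is periodic. A zero $t_0$ of $t\mapsto u(t,x)$ is simple if $u$ changes sign there / $\partial_t u(t_0,x)=b(t_0)\neq0$. *)

theory Defs
  imports "HOL-Analysis.Analysis" "HOL-Computational_Algebra.Polynomial"
begin

definition trig_poly :: "(real \<Rightarrow> real) \<Rightarrow> bool" where
  "trig_poly f \<longleftrightarrow> (\<exists>n c. \<forall>t. f t =
      (\<Sum>i\<le>n. \<Sum>j\<le>n. c i j * sin t ^ i * cos t ^ j))"

definition is_solution_map ::
  "(real \<Rightarrow> real) \<Rightarrow> (real \<Rightarrow> real) \<Rightarrow> (real \<Rightarrow> real \<Rightarrow> real) \<Rightarrow> bool" where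
  "is_solution_map a b u \<longleftrightarrow> (\<forall>x. u 0 x = x \<and>
      (\<forall>t. ((\<lambda>s. u s x) has_real_derivative (a t * \<bar>u t x\<bar> + b t)) (at t)))"

end

theory Submission
  imports Defs
    "HOL-Computational_Algebra.Polynomial_Factorial"
    "HOL-Computational_Algebra.Field_as_Ring"
    "HOL-Computational_Algebra.Fundamental_Theorem_Algebra"
begin

text \<open>If \<open>a = P(h) h'\<close> and \<open>b = Q(h) h'\<close>, every solution is \<open>X \<circ> h\<close> for a solution \<open>X\<close> of
  \<open>X' = P |X| + Q\<close>, and \<open>h\<close> is periodic.

  Conversely, let \<open>A' = a\<close>. Solutions of large modulus do not vanish, which makes \<open>A\<close> and the
  antiderivatives of \<open>b exp (\<minusplus> A)\<close> periodic. Integrating between the zeros \<open>t\<^sub>1(x)\<close>, \<open>t\<^sub>2(x)\<close> shows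
  that both antiderivatives agree at \<open>t\<^sub>1(x)\<close> and \<open>t\<^sub>2(x)\<close>; differentiating in \<open>x\<close> gives
  \<open>A(t\<^sub>1) = A(t\<^sub>2)\<close>, and then \<open>a(t\<^sub>1) b(t\<^sub>2) = a(t\<^sub>2) b(t\<^sub>1)\<close>.

  What remains is an argument in the spirit of Lueroth's theorem. Call \<open>f\<close> invariant if
  \<open>f(t\<^sub>1) = f(t\<^sub>2)\<close> and let \<open>h\<close> be a nonconstant invariant trigonometric polynomial of minimal
  degree. For a relation \<open>f(t\<^sub>1) g(t\<^sub>2) = f(t\<^sub>2) g(t\<^sub>1)\<close>, the greatest common divisor of \<open>h(Z) - h(z)\<close>
  and \<open>f(Z) g(z) - f(z) g(Z)\<close> has coefficients that are again invariant up to a monomial, so by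
  minimality it is \<open>h(Z) - h(z)\<close> itself. Dividing repeatedly by \<open>h - h(t)\<close> yields \<open>f = P(h) g\<close>, for
  \<open>g = 1\<close> and for \<open>g = h'\<close>. That \<open>t\<^sub>2 - t\<^sub>1\<close> tends to zero only serves to exclude the invariance of
  a power of \<open>exp (i t)\<close>.\<close>

section \<open>Trigonometric polynomials as Laurent polynomials in \<open>cis t\<close>\<close>

text \<open>Multiplying by \<open>cis t ^ n\<close> turns a Laurent polynomial with exponents in \<open>[-n, n]\<close> into a polynomial.\<close>

definition trig_degree_le :: "nat \<Rightarrow> (real \<Rightarrow> real) \<Rightarrow> bool" where
  "trig_degree_le n f \<longleftrightarrow> (\<exists>p. degree p \<le> 2 * n \<and>
     (\<forall>t. complex_of_real (f t) * cis t ^ n = poly p (cis t)))"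

text \<open>The conjugate reciprocal polynomial: on the unit circle it turns conjugation of values
  into an operation on coefficients. The formal degree \<open>N\<close> may exceed the degree of
  \<open>p\<close>.\<close>

definition conj_reflect :: "nat \<Rightarrow> complex poly \<Rightarrow> complex poly" where
  "conj_reflect N p = (\<Sum>j\<le>N. monom (cnj (coeff p (N - j))) j)"

lemma coeff_conj_reflect:
  "coeff (conj_reflect N p) j = (if j \<le> N then cnj (coeff p (N - j)) else 0)"
  by (simp add: conj_reflect_def coeff_sum)

lemma degree_conj_reflect: "degree (conj_reflect N p) \<le> N"
  by (rule degree_le) (simp add: coeff_conj_reflect)

lemma poly_eq_sum_le:
  fixes p :: "'a::comm_semiring_1 poly"
  assumes "degree p \<le> N"
  shows "poly p z = (\<Sum>j\<le>N. coeff p j * z ^ j)"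
  unfolding poly_altdef using assms
  by (intro sum.mono_neutral_left) (auto simp: coeff_eq_0)

lemma poly_conj_reflect:
  assumes "degree p \<le> N" "z \<noteq> 0"
  shows "poly (conj_reflect N p) z = z ^ N * cnj (poly p (1 / cnj z))"
proof -
  have "z ^ N * cnj (poly p (1 / cnj z)) = (\<Sum>j\<le>N. cnj (coeff p j) * z ^ (N - j))"
    using assms(2)
    by (simp add: poly_eq_sum_le[OF assms(1)] sum_distrib_left power_one_over power_diff field_simps)
  also have "\<dots> = (\<Sum>j\<le>N. cnj (coeff p (N - j)) * z ^ j)"
    by (rule sum.reindex_bij_witness[of _ "\<lambda>j. N - j" "\<lambda>j. N - j"]) auto
  finally show ?thesis
    by (simp add: conj_reflect_def poly_sum poly_monom)
qed

lemma poly_conj_reflect_circle: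
  assumes "degree p \<le> N" "norm z = 1"
  shows "poly (conj_reflect N p) z = z ^ N * cnj (poly p z)"
proof -
  have "z \<noteq> 0" using assms by auto
  moreover have "1 / cnj z = z"
    using \<open>z \<noteq> 0\<close> assms complex_norm_square[of z] by (simp add: divide_eq_eq)
  ultimately show ?thesis using poly_conj_reflect[OF assms(1)] by simp
qed

lemma infinite_circle: "infinite (range cis)"
proof -
  have "inj_on cis {0<..<pi}"
  proof (rule inj_onI)
    fix x y assume "x \<in> {0<..<pi}" "y \<in> {0<..<pi}" "cis x = cis y"
    then show "x = y" using cos_inj_pi[of x y] by (auto simp: complex_eq_iff)
  qed
  moreover have "infinite {0<..<pi}" by (simp add: infinite_Ioo)
  ultimately have "infinite (cis ` {0<..<pi})" by (simp add: finite_image_iff)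
  then show ?thesis by (meson finite_subset image_mono subset_UNIV)
qed

lemma poly_eq_on_circle:
  fixes p q :: "complex poly"
  assumes "\<And>t. poly p (cis t) = poly q (cis t)"
  shows "p = q"
proof -
  have "range cis \<subseteq> {z. poly (p - q) z = 0}" using assms by auto
  then have "infinite {z. poly (p - q) z = 0}" using infinite_circle finite_subset by blast
  then show ?thesis using poly_roots_finite[of "p - q"] by auto
qed

text \<open>On the circle the conjugate of \<open>p / z ^ n\<close> is
  \<open>conj_reflect (2 * n) p / z ^ n\<close>, so the average of \<open>p\<close> and its
  reflection represents the real part.\<close>

lemma trig_degree_le_Re:
  assumes "degree p \<le> 2 * n"
  shows "trig_degree_le n (\<lambda>t. Re (poly p (cis t) / cis t ^ n))"
  unfolding trig_degree_le_def
proof (intro exI conjI allI)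
  show "degree (smult (1/2) (p + conj_reflect (2 * n) p)) \<le> 2 * n"
    using assms degree_conj_reflect[of "2*n" p] by (simp add: degree_add_le)
  fix t
  let ?z = "cis t"
  have z: "?z \<noteq> 0" by simp
  have cz: "1 / cnj (?z ^ n) = ?z ^ n" by (simp add: cis_cnj power_one_over flip: cis_inverse inverse_eq_divide power_inverse)
  have *: "complex_of_real (Re w) = (w + cnj w) / 2" for w
    by (simp add: complex_eq_iff)
  show "complex_of_real (Re (poly p ?z / ?z ^ n)) * ?z ^ n =
          poly (smult (1/2) (p + conj_reflect (2 * n) p)) ?z"
  proof -
    have "cnj (poly p ?z / ?z ^ n) = cnj (poly p ?z) * ?z ^ n"
      by (metis cz complex_cnj_divide mult.right_neutral times_divide_eq_right)
    then have "(poly p ?z / ?z ^ n + cnj (poly p ?z / ?z ^ n)) / 2 * ?z ^ n =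
        (poly p ?z + ?z ^ (2 * n) * cnj (poly p ?z)) / 2"
      by (simp add: distrib_right mult_2 power_add)
    then show ?thesis unfolding * using poly_conj_reflect_circle[OF assms, of ?z] by simp
  qed
qed

lemma trig_degree_le_eq_Re:
  assumes "complex_of_real x * cis t ^ n = poly p (cis t)"
  shows "x = Re (poly p (cis t) / cis t ^ n)"
  unfolding assms[symmetric] by simp

lemma poly_cis_expand:
  assumes "degree p \<le> 2 * n"
  shows "poly p (cis t) / cis t ^ n = (\<Sum>j\<le>2*n. coeff p j * cis ((real j - real n) * t))"
proof -
  have "cis t ^ j / cis t ^ n = cis ((real j - real n) * t)" for j
    unfolding Complex.DeMoivre cis_divide left_diff_distrib ..
  then show ?thesis
    by (simp add: poly_eq_sum_le[OF assms] sum_divide_distrib flip: times_divide_eq_right)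
qed

text \<open>Fourier form with frequencies \<open>j - n\<close>, the basis of termwise
  differentiation and integration. The \<open>c j\<close> carry no symmetry condition, since real
  parts are taken.\<close>

lemma trig_degree_le_iff:
  "trig_degree_le n f \<longleftrightarrow>
     (\<exists>c. \<forall>t. f t = (\<Sum>j\<le>2*n. Re (c j * cis ((real j - real n) * t))))"
proof
  assume "trig_degree_le n f"
  then obtain p where p: "degree p \<le> 2 * n" "\<And>t. complex_of_real (f t) * cis t ^ n = poly p (cis t)"
    unfolding trig_degree_le_def by blast
  have "f t = (\<Sum>j\<le>2*n. Re (coeff p j * cis ((real j - real n) * t)))" for t
    using trig_degree_le_eq_Re[OF p(2)[of t]] unfolding poly_cis_expand[OF p(1)] Re_sum .
  then show "\<exists>c. \<forall>t. f t = (\<Sum>j\<le>2*n. Re (c j * cis ((real j - real n) * t)))"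
    by (intro exI[of _ "coeff p"]) simp
next
  assume "\<exists>c. \<forall>t. f t = (\<Sum>j\<le>2*n. Re (c j * cis ((real j - real n) * t)))"
  then obtain c where c: "\<And>t. f t = (\<Sum>j\<le>2*n. Re (c j * cis ((real j - real n) * t)))" by blast
  define p where "p = (\<Sum>j\<le>2*n. monom (c j) j)"
  have d: "degree p \<le> 2 * n"
    by (rule degree_le) (simp add: p_def coeff_sum)
  have "f = (\<lambda>t. Re (poly p (cis t) / cis t ^ n))"
  proof
    fix t
    show "f t = Re (poly p (cis t) / cis t ^ n)"
      unfolding poly_cis_expand[OF d] Re_sum c by (intro sum.cong) (auto simp: p_def coeff_sum)
  qed
  then show "trig_degree_le n f" using trig_degree_le_Re[OF d] by simp
qed

section \<open>Closure properties of the degree bound\<close>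

lemma trig_degree_le_mono:
  assumes "trig_degree_le n f" "n \<le> m"
  shows "trig_degree_le m f"
proof -
  obtain p where p: "degree p \<le> 2 * n" "\<And>t. complex_of_real (f t) * cis t ^ n = poly p (cis t)"
    using assms unfolding trig_degree_le_def by blast
  have "degree (monom 1 (m - n) * p) \<le> 2 * m"
    using degree_mult_le[of "monom 1 (m-n)" p] degree_monom_le[of "1::complex" "m - n"] p(1) assms(2) by linarith
  moreover have "complex_of_real (f t) * cis t ^ m = poly (monom 1 (m - n) * p) (cis t)" for t
  proof -
    have "cis t ^ m = cis t ^ (m - n) * cis t ^ n" using assms(2) by (simp flip: power_add)
    then show ?thesis using p(2)[of t] by (simp add: poly_monom mult_ac)
  qed
  ultimately show ?thesis unfolding trig_degree_le_def by blast
qed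

lemma trig_degree_le_const: "trig_degree_le n (\<lambda>_. c)"
  by (rule trig_degree_le_mono[of 0]) (auto simp: trig_degree_le_def intro!: exI[of _ "[:of_real c:]"])

lemma trig_degree_le_add:
  assumes "trig_degree_le n f" "trig_degree_le n g"
  shows "trig_degree_le n (\<lambda>t. f t + g t)"
proof -
  from assms obtain p q where
    "degree p \<le> 2 * n" "\<And>t. complex_of_real (f t) * cis t ^ n = poly p (cis t)"
    "degree q \<le> 2 * n" "\<And>t. complex_of_real (g t) * cis t ^ n = poly q (cis t)"
    unfolding trig_degree_le_def by blast
  then show ?thesis unfolding trig_degree_le_def
    by (intro exI[of _ "p + q"]) (auto simp: degree_add_le distrib_right)
qed

lemma trig_degree_le_mult:
  assumes "trig_degree_le n f" "trig_degree_le m g"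
  shows "trig_degree_le (n + m) (\<lambda>t. f t * g t)"
proof -
  from assms obtain p q where
    p: "degree p \<le> 2 * n" "\<And>t. complex_of_real (f t) * cis t ^ n = poly p (cis t)" and
    q: "degree q \<le> 2 * m" "\<And>t. complex_of_real (g t) * cis t ^ m = poly q (cis t)"
    unfolding trig_degree_le_def by blast
  have "degree (p * q) \<le> 2 * (n + m)"
    using order_trans[OF degree_mult_le add_mono[OF p(1) q(1)]] by (simp add: distrib_left)
  moreover have "complex_of_real (f t * g t) * cis t ^ (n + m) = poly (p * q) (cis t)" for t
    by (simp add: power_add flip: p(2) q(2))
  ultimately show ?thesis unfolding trig_degree_le_def by blast
qed

lemma trig_degree_le_cmult: "trig_degree_le n f \<Longrightarrow> trig_degree_le n (\<lambda>t. c * f t)"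
  using trig_degree_le_mult[OF trig_degree_le_const[of 0 c]] by simp

lemma trig_degree_le_sum:
  "(\<And>i. i \<in> I \<Longrightarrow> trig_degree_le n (f i)) \<Longrightarrow> trig_degree_le n (\<lambda>t. \<Sum>i\<in>I. f i t)"
  by (induction I rule: infinite_finite_induct) (auto intro: trig_degree_le_const trig_degree_le_add)

lemma trig_degree_le_sin: "trig_degree_le 1 sin"
  unfolding trig_degree_le_iff
  \<comment> \<open>Index 2 has frequency 2 - 1 = 1, and
    \<open>Re (- \<i> * cis t) = sin t\<close>.\<close>
  by (intro exI[of _ "\<lambda>j. if j = 2 then -\<i> else 0"] allI) (simp add: numeral_2_eq_2)

lemma trig_degree_le_cos: "trig_degree_le 1 cos"
  unfolding trig_degree_le_iff
  by (intro exI[of _ "\<lambda>j. if j = 2 then 1 else 0"] allI) (simp add: numeral_2_eq_2)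

lemma trig_degree_le_power: "trig_degree_le 1 f \<Longrightarrow> trig_degree_le i (\<lambda>t. f t ^ i)"
proof (induction i)
  case (Suc i)
  then show ?case using trig_degree_le_mult[of 1 f i "\<lambda>t. f t ^ i"] by simp
qed (simp add: trig_degree_le_const)

section \<open>Equivalence with sums of powers of sine and cosine\<close>

lemma trig_poly_imp_degree_le:
  assumes "trig_poly f"
  shows "\<exists>n. trig_degree_le n f"
proof -
  from assms obtain n c where f: "\<And>t. f t = (\<Sum>i\<le>n. \<Sum>j\<le>n. c i j * sin t ^ i * cos t ^ j)"
    unfolding trig_poly_def by blast
  have "trig_degree_le (n + n) (\<lambda>t. \<Sum>i\<le>n. \<Sum>j\<le>n. c i j * sin t ^ i * cos t ^ j)"
    by (intro trig_degree_le_sum trig_degree_le_mult trig_degree_le_cmult)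
      (auto intro: trig_degree_le_mono[OF trig_degree_le_power] trig_degree_le_sin trig_degree_le_cos)
  moreover have "f = (\<lambda>t. \<Sum>i\<le>n. \<Sum>j\<le>n. c i j * sin t ^ i * cos t ^ j)" using f by (rule ext)
  ultimately show ?thesis by (intro exI) simp
qed

text \<open>\<open>trig_poly\<close> has one bound for both exponents, but a factor
  \<open>sin t\<close> or \<open>cos t\<close> raises only one of them; zero coefficients fill the
  gap.\<close>

lemma trig_polyI_wide:
  assumes "\<And>t. f t = (\<Sum>i\<le>n. \<Sum>j\<le>m. c i j * sin t ^ i * cos t ^ j)"
  shows "trig_poly f"
  unfolding trig_poly_def
proof (intro exI allI)
  fix t
  let ?N = "max n m"
  have "f t = (\<Sum>i\<le>n. \<Sum>j\<le>?N. (if i \<le> n \<and> j \<le> m then c i j else 0) * sin t ^ i * cos t ^ j)"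
    unfolding assms by (rule sum.cong[OF refl], intro sum.mono_neutral_cong_left) auto
  also have "\<dots> = (\<Sum>i\<le>?N. \<Sum>j\<le>?N. (if i \<le> n \<and> j \<le> m then c i j else 0) * sin t ^ i * cos t ^ j)"
    by (intro sum.mono_neutral_left) auto
  finally show "f t = \<dots>" .
qed

lemma trig_poly_const: "trig_poly (\<lambda>_. c)"
  by (rule trig_polyI_wide[where n = 0 and m = 0 and c = "\<lambda>_ _. c"]) simp

lemma trig_poly_cmult: "trig_poly f \<Longrightarrow> trig_poly (\<lambda>t. k * f t)"
proof -
  assume "trig_poly f"
  then obtain n c where "\<And>t. f t = (\<Sum>i\<le>n. \<Sum>j\<le>n. c i j * sin t ^ i * cos t ^ j)"
    unfolding trig_poly_def by blast
  then show ?thesis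
    by (intro trig_polyI_wide[where n = n and m = n and c = "\<lambda>i j. k * c i j"]) (simp add: sum_distrib_left mult.assoc)
qed

lemma sin_cos_sum_pad:
  fixes e :: "nat \<Rightarrow> nat \<Rightarrow> real"
  assumes "k \<le> K"
  shows "(\<Sum>i\<le>k. \<Sum>j\<le>k. e i j * x ^ i * y ^ j) =
      (\<Sum>i\<le>K. \<Sum>j\<le>K. (if i \<le> k \<and> j \<le> k then e i j else 0) * x ^ i * y ^ j)"
proof -
  have "(\<Sum>i\<le>k. \<Sum>j\<le>k. e i j * x ^ i * y ^ j) =
    (\<Sum>i\<le>k. \<Sum>j\<le>K. (if i \<le> k \<and> j \<le> k then e i j else 0) * x ^ i * y ^ j)"
    by (rule sum.cong[OF refl], intro sum.mono_neutral_cong_left) (use assms in auto)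
  also have "\<dots> = (\<Sum>i\<le>K. \<Sum>j\<le>K. (if i \<le> k \<and> j \<le> k then e i j else 0) * x ^ i * y ^ j)"
    by (intro sum.mono_neutral_left) (use assms in auto)
  finally show ?thesis .
qed

lemma trig_poly_add:
  assumes "trig_poly f" "trig_poly g"
  shows "trig_poly (\<lambda>t. f t + g t)"
proof -
  from assms(1) obtain n c where f: "\<And>t. f t = (\<Sum>i\<le>n. \<Sum>j\<le>n. c i j * sin t ^ i * cos t ^ j)"
    unfolding trig_poly_def by blast
  from assms(2) obtain m d where g: "\<And>t. g t = (\<Sum>i\<le>m. \<Sum>j\<le>m. d i j * sin t ^ i * cos t ^ j)"
    unfolding trig_poly_def by blast
  let ?N = "max n m"
  let ?e = "\<lambda>i j. (if i \<le> n \<and> j \<le> n then c i j else 0) + (if i \<le> m \<and> j \<le> m then d i j else 0)"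
  have "f t + g t = (\<Sum>i\<le>?N. \<Sum>j\<le>?N. ?e i j * sin t ^ i * cos t ^ j)" for t
    unfolding f g distrib_right sum.distrib
    by (intro arg_cong2[of _ _ _ _ "(+)"] sin_cos_sum_pad) auto
  then show ?thesis by (rule trig_polyI_wide)
qed

lemma trig_poly_sin_mult:
  assumes "trig_poly f"
  shows "trig_poly (\<lambda>t. sin t * f t)"
proof -
  from assms obtain n c where f: "\<And>t. f t = (\<Sum>i\<le>n. \<Sum>j\<le>n. c i j * sin t ^ i * cos t ^ j)"
    unfolding trig_poly_def by blast
  show ?thesis
    by (rule trig_polyI_wide[where n = "Suc n" and m = n and c = "\<lambda>i j. if i = 0 then 0 else c (i - 1) j"])
      (simp add: f sum.atMost_Suc_shift sum_distrib_left mult_ac del: sum.atMost_Suc)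
qed

lemma trig_poly_cos_mult:
  assumes "trig_poly f"
  shows "trig_poly (\<lambda>t. cos t * f t)"
proof -
  from assms obtain n c where f: "\<And>t. f t = (\<Sum>i\<le>n. \<Sum>j\<le>n. c i j * sin t ^ i * cos t ^ j)"
    unfolding trig_poly_def by blast
  show ?thesis
    by (rule trig_polyI_wide[where n = n and m = "Suc n" and c = "\<lambda>i j. if j = 0 then 0 else c i (j - 1)"])
      (simp add: f sum.atMost_Suc_shift sum_distrib_left mult_ac del: sum.atMost_Suc)
qed

lemma trig_poly_sum: "(\<And>i. i \<in> I \<Longrightarrow> trig_poly (f i)) \<Longrightarrow> trig_poly (\<lambda>t. \<Sum>i\<in>I. f i t)"
  by (induction I rule: infinite_finite_induct) (auto intro: trig_poly_const trig_poly_add)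

lemma trig_poly_cos_sin_nat: "trig_poly (\<lambda>t. cos (real k * t)) \<and> trig_poly (\<lambda>t. sin (real k * t))"
proof (induction k)
  case 0
  then show ?case by (simp add: trig_poly_const)
next
  case (Suc k)
  have 1: "cos (real (Suc k) * t) = cos t * cos (real k * t) + (-1) * (sin t * sin (real k * t))" for t
    by (simp add: distrib_right cos_add)
  have 2: "sin (real (Suc k) * t) = sin t * cos (real k * t) + cos t * sin (real k * t)" for t
    by (simp add: distrib_right sin_add)
  show ?case unfolding 1 2
    using Suc by (intro conjI trig_poly_add trig_poly_cmult trig_poly_sin_mult trig_poly_cos_mult) auto
qed

lemma trig_poly_Re_cis: "trig_poly (\<lambda>t. Re (c * cis ((real j - real n) * t)))"
proof (cases "n \<le> j")
  case True
  then have "Re (c * cis ((real j - real n) * t)) = Re c * cos (real (j - n) * t) + (- Im c) * sin (real (j - n) * t)" for t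
    by (simp add: of_nat_diff)
  then show ?thesis
    using trig_poly_cos_sin_nat[of "j - n"] by (simp only: trig_poly_add trig_poly_cmult)
next
  case False
  have 1: "(real j - real n) * t = - (real (n - j) * t)" for t
    using False by (simp add: of_nat_diff left_diff_distrib)
  have "Re (c * cis ((real j - real n) * t)) = Re c * cos (real (n - j) * t) + Im c * sin (real (n - j) * t)" for t
    unfolding 1 by simp
  then show ?thesis
    using trig_poly_cos_sin_nat[of "n - j"] by (simp only: trig_poly_add trig_poly_cmult)
qed

lemma trig_degree_le_imp_trig_poly:
  assumes "trig_degree_le n f"
  shows "trig_poly f"
proof -
  obtain c where "\<And>t. f t = (\<Sum>j\<le>2*n. Re (c j * cis ((real j - real n) * t)))"
    using assms unfolding trig_degree_le_iff by blast
  then have f: "f = (\<lambda>t. \<Sum>j\<le>2*n. Re (c j * cis ((real j - real n) * t)))" by auto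
  show ?thesis unfolding f by (rule trig_poly_sum) (rule trig_poly_Re_cis)
qed

section \<open>Derivatives, antiderivatives and periodicity\<close>

lemma Re_cis_deriv:
  "((\<lambda>t. Re (c * cis (m * t))) has_real_derivative Re ((\<i> * of_real m * c) * cis (m * t))) (at t)"
proof -
  have "((\<lambda>t. Re c * cos (m * t) - Im c * sin (m * t)) has_real_derivative
      Re c * (- sin (m * t) * m) - Im c * (cos (m * t) * m)) (at t)"
    by (rule derivative_eq_intros refl | simp)+
  then show ?thesis
    unfolding times_complex.sel cis.sel by (rule DERIV_cong) (simp add: algebra_simps)
qed

lemma trig_degree_le_deriv:
  assumes "trig_degree_le n f"
  shows "\<exists>g. trig_degree_le n g \<and> (\<forall>t. (f has_real_derivative g t) (at t))"
proof -
  obtain c where "\<And>t. f t = (\<Sum>j\<le>2*n. Re (c j * cis ((real j - real n) * t)))"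
    using assms unfolding trig_degree_le_iff by blast
  then have f: "f = (\<lambda>t. \<Sum>j\<le>2*n. Re (c j * cis ((real j - real n) * t)))" by auto
  define g where "g = (\<lambda>t. \<Sum>j\<le>2*n. Re ((\<i> * of_real (real j - real n) * c j) * cis ((real j - real n) * t)))"
  have "(f has_real_derivative g t) (at t)" for t
    unfolding f g_def by (intro DERIV_sum Re_cis_deriv)
  moreover have "trig_degree_le n g" unfolding trig_degree_le_iff g_def
    by (intro exI[of _ "\<lambda>j. \<i> * of_real (real j - real n) * c j"] allI refl)
  ultimately show ?thesis by (intro exI[of _ g] conjI allI)
qed

text \<open>Every frequency except zero, at index \<open>j = n\<close>, integrates to a multiple of
  itself; \<open>k\<close> is the mean value, which has to be taken out.\<close>

lemma trig_degree_le_antideriv: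
  assumes "trig_degree_le n f"
  shows "\<exists>g k. trig_degree_le n g \<and> (\<forall>t. (g has_real_derivative f t - k) (at t))"
proof -
  obtain c where "\<forall>t. f t = (\<Sum>j\<le>2*n. Re (c j * cis ((real j - real n) * t)))"
    using assms unfolding trig_degree_le_iff ..
  then have f: "f t = (\<Sum>j\<le>2*n. Re (c j * cis ((real j - real n) * t)))" for t ..
  define d where "d = (\<lambda>j. if j = n then 0 else c j / (\<i> * of_real (real j - real n)))"
  define g where "g = (\<lambda>t. \<Sum>j\<le>2*n. Re (d j * cis ((real j - real n) * t)))"
  have 1: "(g has_real_derivative (\<Sum>j\<le>2*n. Re ((\<i> * of_real (real j - real n) * d j) * cis ((real j - real n) * t)))) (at t)" for t
    unfolding g_def by (intro DERIV_sum Re_cis_deriv)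
  have 2: "\<i> * of_real (real j - real n) * d j = c j - (if j = n then c n else 0)" for j
    by (auto simp: d_def)
  have 3: "(\<Sum>j\<le>2*n. Re ((\<i> * of_real (real j - real n) * d j) * cis ((real j - real n) * t))) = f t - Re (c n)" for t
  proof -
    have "Re ((\<i> * of_real (real j - real n) * d j) * cis ((real j - real n) * t)) =
        Re (c j * cis ((real j - real n) * t)) - (if j = n then Re (c n) else 0)" for j
      unfolding 2 by (cases "j = n") auto
    then show ?thesis
      by (simp only: sum_subtractf f) simp
  qed
  have "(g has_real_derivative f t - Re (c n)) (at t)" for t using 1[of t] unfolding 3 .
  moreover have "trig_degree_le n g" unfolding trig_degree_le_iff g_def
    by (intro exI[of _ d] allI refl)
  ultimately show ?thesis by (intro exI[of _ g] exI[of _ "Re (c n)"] conjI allI)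
qed

lemma trig_degree_le_periodic:
  assumes "trig_degree_le n f"
  shows "f (t + 2 * pi) = f t"
proof -
  obtain p where "degree p \<le> 2 * n \<and> (\<forall>t. complex_of_real (f t) * cis t ^ n = poly p (cis t))"
    using assms unfolding trig_degree_le_def ..
  then have "f s = Re (poly p (cis s) / cis s ^ n)" for s by (intro trig_degree_le_eq_Re) simp
  moreover have "cis (t + 2 * pi) = cis t" by (simp add: complex_eq_iff)
  ultimately show ?thesis by simp
qed

lemma trig_degree_le_continuous:
  assumes "trig_degree_le n f"
  shows "continuous_on S f"
proof -
  obtain g where "trig_degree_le n g \<and> (\<forall>t. (f has_real_derivative g t) (at t))"
    using trig_degree_le_deriv[OF assms] ..
  then have g: "(f has_real_derivative g t) (at t)" for t by simp
  show ?thesis by (rule DERIV_continuous_on[OF has_field_derivative_at_within[OF g]])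
qed

section \<open>Bivariate polynomials\<close>

text \<open>A polynomial in \<open>z\<close> and \<open>Z\<close> is a \<open>complex poly poly\<close> with outer variable \<open>Z\<close>.\<close>

definition eval_inner :: "complex \<Rightarrow> complex poly poly \<Rightarrow> complex poly" where
  "eval_inner z N = map_poly (\<lambda>p. poly p z) N"

lemma coeff_eval_inner [simp]: "coeff (eval_inner z N) j = poly (coeff N j) z"
  by (simp add: eval_inner_def coeff_map_poly)

lemma eval_inner_add: "eval_inner z (M + N) = eval_inner z M + eval_inner z N"
  and eval_inner_diff: "eval_inner z (M - N) = eval_inner z M - eval_inner z N"
  and eval_inner_smult: "eval_inner z (smult p N) = smult (poly p z) (eval_inner z N)"
  and eval_inner_mult: "eval_inner z (M * N) = eval_inner z M * eval_inner z N"
  and eval_inner_monom: "eval_inner z (monom p j) = monom (poly p z) j"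
  by (auto simp: poly_eq_iff coeff_mult poly_sum)

lemma eval_inner_dvd: "M dvd N \<Longrightarrow> eval_inner z M dvd eval_inner z N"
  by (auto simp: dvd_def eval_inner_mult)

definition lift_outer :: "complex poly \<Rightarrow> complex poly poly" where
  "lift_outer p = map_poly (\<lambda>c. [:c:]) p"

lemma coeff_lift_outer [simp]: "coeff (lift_outer p) j = [:coeff p j:]"
  by (simp add: lift_outer_def coeff_map_poly)

lemma eval_inner_lift_outer [simp]: "eval_inner z (lift_outer p) = p"
  by (simp add: poly_eq_iff)

text \<open>Exchanges the roles of the variables: with \<open>Z\<close> set to the number
  \<open>c\<close>, each coefficient of the remaining polynomial in \<open>z\<close> is a polynomial
  in \<open>c\<close>.\<close>

lemma coeff_poly_const:
  "coeff (poly N [:c:]) i = poly (map_poly (\<lambda>p. coeff p i) N) c"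
proof (induction N)
  case (pCons a N)
  then show ?case by (cases "pCons a N = 0") (simp_all add: map_poly_pCons)
qed simp

text \<open>Gauss's lemma: contents multiply, so \<open>c\<close> must divide the content of the
  cofactor.\<close>

lemma primitive_dvd_smult_cancel:
  fixes G N :: "complex poly poly"
  assumes "Polynomial.content G = 1" "G dvd smult c N" "c \<noteq> 0"
  shows "G dvd N"
proof -
  obtain S where S: "smult c N = G * S" using assms(2) by (elim dvdE)
  have "[:c:] dvd [:c:] * N" by (rule dvd_triv_left)
  then have "[:c:] dvd G * S" unfolding S[symmetric] by simp
  then have "c dvd Polynomial.content S"
    unfolding const_poly_dvd_iff_dvd_content content_mult assms(1) by simp
  then have "[:c:] dvd S" unfolding const_poly_dvd_iff_dvd_content .
  then obtain S' where "S = [:c:] * S'" by (elim dvdE)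
  then have "smult c N = smult c (G * S')" using S by simp
  then have "smult c (N - G * S') = 0" by (simp add: smult_diff_right)
  then have "N = G * S'" using assms(3) by simp
  then show ?thesis by simp
qed

text \<open>An element of minimal degree of the ideal spanned by two polynomials divides, up to
  its content, every element of the ideal by pseudo-division.\<close>

lemma bezout_up_to_content:
  fixes M N :: "complex poly poly"
  assumes "M \<noteq> 0"
  shows "\<exists>G \<delta> \<alpha> \<beta>. G dvd M \<and> G dvd N \<and> \<delta> \<noteq> 0 \<and> smult \<delta> G = \<alpha> * M + \<beta> * N"
proof -
  define I where "I = {K. \<exists>\<alpha> \<beta>. K = \<alpha> * M + \<beta> * N}"
  have MI: "M \<in> I" unfolding I_def by (intro CollectI exI[of _ 1] exI[of _ 0]) simp
  have NI: "N \<in> I" unfolding I_def by (intro CollectI exI[of _ 0] exI[of _ 1]) simp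
  define K where "K = arg_min degree (\<lambda>K. K \<in> I \<and> K \<noteq> 0)"
  have K: "K \<in> I" "K \<noteq> 0" and least: "\<And>L. L \<in> I \<Longrightarrow> L \<noteq> 0 \<Longrightarrow> degree K \<le> degree L"
    using arg_min_natI[of "\<lambda>K. K \<in> I \<and> K \<noteq> 0" M degree]
      arg_min_nat_le[of "\<lambda>K. K \<in> I \<and> K \<noteq> 0" _ degree] MI assms unfolding K_def by auto
  \<comment> \<open>Pseudo-division multiplies by a power of the leading coefficient of
    \<open>K\<close>; that factor can be cancelled for a primitive divisor.\<close>
  define G where "G = primitive_part K"
  have G1: "Polynomial.content G = 1" unfolding G_def using K(2) by (rule content_primitive_part)
  have KG: "smult (Polynomial.content K) G = K" unfolding G_def by simp
  have dvd: "G dvd L" if "L \<in> I" for L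
  proof -
    obtain q r where qr: "pseudo_divmod L K = (q, r)" by (cases "pseudo_divmod L K")
    define c where "c = lead_coeff K ^ (Suc (degree L) - degree K)"
    have eq: "smult c L = K * q + r" and deg: "r = 0 \<or> degree r < degree K"
      using pseudo_divmod[OF K(2) qr] unfolding c_def by auto
    obtain a b where L: "L = a * M + b * N" using \<open>L \<in> I\<close> unfolding I_def by auto
    obtain a' b' where K': "K = a' * M + b' * N" using K(1) unfolding I_def by auto
    have "r = smult c L - K * q" using eq by simp
    also have "\<dots> = (smult c a - a' * q) * M + (smult c b - b' * q) * N"
      unfolding L by (subst K') (simp add: algebra_simps smult_add_right)
    finally have "r \<in> I" unfolding I_def by blast
    then have "r = 0" using least[of r] deg by fastforce
    then have "smult c L = K * q" using eq by simp
    then have "G dvd smult c L" using KG by (metis dvd_smult dvd_refl dvd_mult2)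
    moreover have "c \<noteq> 0" using K(2) unfolding c_def by simp
    ultimately show ?thesis using primitive_dvd_smult_cancel[OF G1] by blast
  qed
  obtain a b where "K = a * M + b * N" using K(1) unfolding I_def by auto
  then have "smult (Polynomial.content K) G = a * M + b * N" using KG by simp
  moreover have "Polynomial.content K \<noteq> 0" using K(2) by simp
  ultimately show ?thesis using dvd[OF MI] dvd[OF NI] by blast
qed

text \<open>\<open>[:0, 1:]\<close> is prime, so by unique factorisation a divisor of its power is a
  power of it up to a unit.\<close>

lemma monom_factor:
  fixes p q :: "complex poly"
  assumes "p * q = monom a d" "a \<noteq> 0"
  shows "\<exists>c k. c \<noteq> 0 \<and> k \<le> d \<and> p = monom c k"
proof -
  have "p * q = smult a ([:0, 1:] ^ d)" using assms(1) by (simp add: monom_altdef)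
  then have "p dvd smult a ([:0, 1:] ^ d)" by (metis dvd_triv_left)
  then have dvd: "p dvd [:0, 1:] ^ d" using assms(2) by (simp add: dvd_smult_iff)
  have "prime [:0, 1 :: complex:]"
    using prime_elem_linear_field_poly[of 1 0] by (simp add: prime_def normalize_poly_def flip: one_pCons)
  then obtain k where k: "k \<le> d" "normalize p = normalize ([:0, 1:] ^ k)"
    using divides_primepow_weak[OF _ dvd] by blast
  then have "p dvd [:0, 1:] ^ k" "[:0, 1:] ^ k dvd p" by (auto dest: associatedD1 associatedD2)
  then obtain r s where "[:0, 1:] ^ k = p * r" "p = [:0, 1:] ^ k * s" by (metis dvdE)
  then have "[:0, 1:] ^ k * (s * r) = [:0, 1:] ^ k * 1" by (metis mult.assoc mult.right_neutral)
  then have "s * r = 1" by (subst (asm) mult_cancel_left) simp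
  then have "is_unit s" by (metis dvd_triv_left)
  then obtain c where "s = [:c:]" "c \<noteq> 0" unfolding is_unit_poly_iff by (metis not_is_unit_0)
  then show ?thesis using \<open>p = [:0, 1:] ^ k * s\<close> k(1)
    by (intro exI[of _ c] exI[of _ k]) (simp add: monom_altdef)
qed

section \<open>Reflection, divisibility and specialisation of \<open>z\<close>\<close>

lemma conj_reflect_mult:
  assumes "degree p \<le> N" "degree q \<le> M"
  shows "conj_reflect (N + M) (p * q) = conj_reflect N p * conj_reflect M q"
proof (rule poly_eq_on_circle)
  fix t
  have "degree (p * q) \<le> N + M" using order_trans[OF degree_mult_le add_mono[OF assms]] .
  then show "poly (conj_reflect (N + M) (p * q)) (cis t) = poly (conj_reflect N p * conj_reflect M q) (cis t)"
    by (simp add: poly_conj_reflect_circle assms power_add)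
qed

lemma conj_reflect_dvd:
  assumes "g dvd p" "degree p \<le> N"
  shows "conj_reflect (degree g) g dvd conj_reflect N p"
proof (cases "p = 0")
  case True
  then show ?thesis by (simp add: conj_reflect_def)
next
  case False
  obtain r where r: "p = g * r" using assms(1) by (elim dvdE)
  then have "degree p = degree g + degree r" using False by (auto simp: degree_mult_eq)
  \<comment> \<open>Any excess of \<open>N\<close> over the degree of \<open>p\<close> is charged to
    the cofactor.\<close>
  then have d: "degree r \<le> N - degree g" "degree g + (N - degree g) = N" using assms(2) by auto
  have "conj_reflect N p = conj_reflect (degree g) g * conj_reflect (N - degree g) r"
    using conj_reflect_mult[OF order_refl d(1), of g] d(2) r by simp
  then show ?thesis by simp
qed

text \<open>This is the realness of \<open>f\<close> read off from the coefficients.\<close>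

lemma trig_degree_le_reflect:
  assumes "degree p \<le> 2 * n" "\<And>t. complex_of_real (f t) * cis t ^ n = poly p (cis t)"
  shows "conj_reflect (2 * n) p = p"
proof (rule poly_eq_on_circle)
  fix t
  have "cis t ^ n * cnj (cis t ^ n) = 1" by (simp add: cis_cnj cis_mult flip: power_mult_distrib)
  then have "cis t ^ (2 * n) * cnj (cis t ^ n) = cis t ^ n"
    by (simp add: mult_2 power_add mult.assoc)
  then show "poly (conj_reflect (2 * n) p) (cis t) = poly p (cis t)"
    using poly_conj_reflect_circle[OF assms(1), of "cis t"]
    by (simp flip: assms(2))
qed

text \<open>Read as \<open>p / z ^ n\<close>, both extreme Laurent coefficients vanish; division by
  \<open>z\<close> recentres the remaining exponents.\<close>

lemma degree_drop_ends:
  assumes "degree p \<le> 2 * n" "coeff p 0 = 0" "coeff p (2 * n) = 0" "0 < n"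
  shows "\<exists>q. p = pCons 0 q \<and> degree q \<le> 2 * (n - 1)"
proof -
  obtain q where q: "p = pCons 0 q" using assms(2) by (cases p) auto
  have "degree q \<le> 2 * (n - 1)"
  proof (rule degree_le, intro allI impI)
    fix i assume "2 * (n - 1) < i"
    then have "2 * n \<le> Suc i" by linarith
    then have "coeff p (Suc i) = 0"
      using assms(1,3) by (metis coeff_eq_0 le_less_trans le_neq_implies_less)
    then show "coeff q i = 0" unfolding q by simp
  qed
  then show ?thesis using q by blast
qed

text \<open>The Bezout identity survives specialisation of \<open>z\<close>, so \<open>G\<close>
  specialises to a greatest common divisor away from the zeros of \<delta>.\<close>

lemma dvd_eval_gcd:
  assumes "smult \<delta> G = \<alpha> * M + \<beta> * N" "poly \<delta> z \<noteq> 0"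
    and "P dvd eval_inner z M" "P dvd eval_inner z N"
  shows "P dvd eval_inner z G"
proof -
  have "smult (poly \<delta> z) (eval_inner z G) = eval_inner z \<alpha> * eval_inner z M + eval_inner z \<beta> * eval_inner z N"
    using arg_cong[OF assms(1), of "eval_inner z"]
    by (simp only: eval_inner_smult eval_inner_add eval_inner_mult)
  moreover have "P dvd \<dots>" using assms(3,4) by (intro dvd_add dvd_mult)
  ultimately have "P dvd smult (poly \<delta> z) (eval_inner z G)" by simp
  then show ?thesis using assms(2) by (simp add: dvd_smult_iff)
qed

lemma associated_imp_smult:
  fixes p q :: "complex poly"
  assumes "p dvd q" "q dvd p" "q \<noteq> 0"
  shows "\<exists>c. c \<noteq> 0 \<and> q = smult c p"
proof -
  obtain r where r: "q = p * r" using assms(1) by (elim dvdE)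
  have "p \<noteq> 0" "r \<noteq> 0" using r assms(3) by auto
  then have "degree r = 0"
    using dvd_imp_degree_le[OF assms(2)] r by (simp add: degree_mult_eq)
  then obtain c where "r = [:c:]" by (rule degree_eq_zeroE)
  then show ?thesis using r \<open>r \<noteq> 0\<close> by (intro exI[of _ c]) auto
qed

lemma smult_imp_associated:
  fixes p q :: "'a::field poly"
  assumes "p = smult c q" "c \<noteq> 0"
  shows "q dvd p" "p dvd q"
  using assms dvd_smult[OF dvd_refl[of q], of c] by (simp_all add: smult_dvd_iff)

text \<open>Apart from the constant \<open>a\<close> the Laurent polynomial is real on the circle,
  so for \<open>a \<noteq> 0\<close> reflection multiplies it by \<open>cnj a / a\<close>.\<close>

lemma self_reflect_dvd:
  assumes "degree p \<le> 2 * n"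
    and "\<And>t. poly p (cis t) = a * complex_of_real (r t) * cis t ^ n"
  shows "conj_reflect (2 * n) p dvd p"
proof (cases "a = 0")
  case True
  then have "p = 0" by (intro poly_eq_on_circle) (simp add: assms(2))
  then show ?thesis by simp
next
  case False
  have "p = smult (a / cnj a) (conj_reflect (2 * n) p)"
  proof (rule poly_eq_on_circle)
    fix t
    have "cis t ^ n * cnj (cis t ^ n) = 1" by (simp add: cis_cnj cis_mult flip: power_mult_distrib)
    then have 1: "cis t ^ (2 * n) * cnj (cis t ^ n) = cis t ^ n"
      by (simp add: mult_2 power_add mult.assoc)
    have "poly (conj_reflect (2 * n) p) (cis t) = cnj a * r t * (cis t ^ (2 * n) * cnj (cis t ^ n))"
      using poly_conj_reflect_circle[OF assms(1), of "cis t"] by (simp add: assms(2))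
    then show "poly p (cis t) = poly (smult (a / cnj a) (conj_reflect (2 * n) p)) (cis t)"
      unfolding 1 using False by (simp add: assms(2))
  qed
  from smult_imp_associated(1)[OF this] False show ?thesis by simp
qed

text \<open>Multiplying both sides by \<delta> absorbs the exceptional points.\<close>

lemma poly_eq_on_circle_generic:
  fixes p q :: "complex poly"
  assumes "\<delta> \<noteq> 0" "\<And>t. poly \<delta> (cis t) \<noteq> 0 \<Longrightarrow> poly p (cis t) = poly q (cis t)"
  shows "p = q"
proof -
  have "\<delta> * p = \<delta> * q" by (rule poly_eq_on_circle) (use assms(2) in force)
  then show ?thesis using assms(1) by simp
qed

lemma degree_poly_const:
  assumes "\<And>j. degree (coeff N j) \<le> D"
  shows "degree (poly N [:c:]) \<le> D"
proof (rule degree_le, intro allI impI)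
  fix i assume i: "D < i"
  have "map_poly (\<lambda>p. coeff p i) N = 0"
    by (rule poly_eqI) (simp add: coeff_map_poly coeff_eq_0[OF le_less_trans[OF assms i]])
  then show "coeff (poly N [:c:]) i = 0" by (simp add: coeff_poly_const)
qed

text \<open>Degrees in \<open>z\<close> add, so if \<open>G\<close> exhausts the bound
  \<open>D\<close>, nothing is left for the cofactor. This is applied with \<open>Z\<close> set to
  numbers \<open>c\<close> at which the coefficient of \<open>z ^ D\<close> in \<open>G\<close>
  survives; the factor \<open>?L\<close> covers the other \<open>c\<close>.\<close>

lemma inner_degree_cofactor:
  fixes G q :: "complex poly poly"
  assumes "\<And>j. degree (coeff (G * q) j) \<le> D" "coeff (coeff G i) D \<noteq> 0"
  shows "degree (coeff q j) = 0"
proof -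
  let ?L = "map_poly (\<lambda>p. coeff p D) G"
  have L: "?L \<noteq> 0"
  proof
    assume "?L = 0"
    then have "coeff ?L i = 0" by simp
    then show False using assms(2) by (simp add: coeff_map_poly)
  qed
  have "map_poly (\<lambda>p. coeff p e) q = 0" if e: "0 < e" for e
  proof -
    have "poly (?L * map_poly (\<lambda>p. coeff p e) q) c = 0" for c
    proof (cases "poly ?L c = 0")
      case False
      then have cG: "coeff (poly G [:c:]) D \<noteq> 0" by (simp add: coeff_poly_const)
      have *: "degree (poly G [:c:] * poly q [:c:]) \<le> D"
        using degree_poly_const[OF assms(1), of c] by simp
      have "coeff (poly q [:c:]) e = 0"
      proof (cases "poly q [:c:] = 0")
        case False
        moreover have "poly G [:c:] \<noteq> 0" using cG by auto
        ultimately have "degree (poly G [:c:]) + degree (poly q [:c:]) \<le> D"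
          using * by (simp add: degree_mult_eq)
        then have "degree (poly q [:c:]) = 0" using le_degree[OF cG] by linarith
        then show ?thesis using e by (simp add: coeff_eq_0)
      qed simp
      then show ?thesis by (simp add: coeff_poly_const)
    qed simp
    then have "?L * map_poly (\<lambda>p. coeff p e) q = 0" using poly_all_0_iff_0 by blast
    then show ?thesis using L by simp
  qed
  then have "coeff (map_poly (\<lambda>p. coeff p e) q) j = 0" if "0 < e" for e using that by simp
  then have "coeff (coeff q j) e = 0" if "0 < e" for e using that by (simp add: coeff_map_poly)
  then show ?thesis by (metis leading_coeff_0_iff degree_0 gr0I)
qed

section \<open>Invariant trigonometric polynomials\<close>

text \<open>The two zeros of a solution, reduced to what the algebra uses. Genericity allows
  cancelling a nonzero polynomial at the points of a pair; \<open>ratio\<close> says that no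
  positive power of \<open>cis\<close> is invariant.\<close>

locale point_pairs =
  fixes F :: "'i filter" and \<theta>1 \<theta>2 :: "'i \<Rightarrow> real"
  assumes nontrivial: "F \<noteq> bot"
    and generic1: "p \<noteq> 0 \<Longrightarrow> \<forall>\<^sub>F x in F. poly (p :: complex poly) (cis (\<theta>1 x)) \<noteq> 0"
    and generic2: "p \<noteq> 0 \<Longrightarrow> \<forall>\<^sub>F x in F. poly (p :: complex poly) (cis (\<theta>2 x)) \<noteq> 0"
    and ratio: "0 < e \<Longrightarrow> \<forall>\<^sub>F x in F. cis (\<theta>1 x) ^ e \<noteq> cis (\<theta>2 x) ^ e"
begin

definition invariant :: "(real \<Rightarrow> real) \<Rightarrow> bool" where
  "invariant f \<longleftrightarrow> (\<forall>\<^sub>F x in F. f (\<theta>1 x) = f (\<theta>2 x))"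

text \<open>The gcd \<open>G\<close> of \<open>M\<close> and \<open>N\<close> is shown to have full
  degree \<open>2 * d\<close> in \<open>z\<close>. Then \<open>M / G\<close> depends on
  \<open>Z\<close> only, and such a factor of \<open>M\<close> is constant, so \<open>M\<close>
  divides \<open>N\<close> at every \<open>z0\<close>.\<close>

lemma minimal_invariant_dvd:
  assumes H: "degree H \<le> 2 * d" "\<And>t. complex_of_real (h t) * cis t ^ d = poly H (cis t)"
    and inv: "invariant h" and d: "0 < d" and H0: "coeff H 0 \<noteq> 0" and Hd: "coeff H (2 * d) \<noteq> 0"
    and least: "\<And>g. trig_degree_le (d - 1) g \<Longrightarrow> invariant g \<Longrightarrow> \<exists>c. \<forall>t. g t = c"
    and F1: "degree F1 \<le> 2 * n" "\<And>t. complex_of_real (f1 t) * cis t ^ n = poly F1 (cis t)"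
    and F2: "degree F2 \<le> 2 * n" "\<And>t. complex_of_real (f2 t) * cis t ^ n = poly F2 (cis t)" "F2 \<noteq> 0"
    and cross: "\<forall>\<^sub>F x in F. f1 (\<theta>1 x) * f2 (\<theta>2 x) = f1 (\<theta>2 x) * f2 (\<theta>1 x)"
  shows "smult (z0 ^ d) H - monom (poly H z0) d dvd
      smult (poly F2 z0) F1 - smult (poly F1 z0) F2"
proof -
  \<comment> \<open>With denominators cleared, \<open>D z\<close> stands for
    \<open>h(Z) - h(z)\<close> and \<open>C z\<close> for \<open>f1(Z) f2(z) - f1(z) f2(Z)\<close>;
    \<open>M\<close> and \<open>N\<close> are the same with \<open>z\<close> as a variable.\<close>
  define D where "D z = smult (z ^ d) H - monom (poly H z) d" for z
  define C where "C z = smult (poly F2 z) F1 - smult (poly F1 z) F2" for z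
  define M where "M = smult (monom 1 d) (lift_outer H) - monom H d"
  define N where "N = smult F2 (lift_outer F1) - smult F1 (lift_outer F2)"
  have eM: "eval_inner z M = D z" for z
    unfolding M_def D_def by (simp add: eval_inner_diff eval_inner_smult eval_inner_monom poly_monom)
  have eN: "eval_inner z N = C z" for z
    unfolding N_def C_def by (simp add: eval_inner_diff eval_inner_smult)
  have cM: "coeff M j = monom (coeff H j) d - (if j = d then H else 0)" for j
    unfolding M_def by (auto simp: smult_monom mult.commute[of "monom 1 d"])
  have cM0: "coeff M 0 = monom (coeff H 0) d" and cMd: "coeff M (2 * d) = monom (coeff H (2 * d)) d"
    using d by (auto simp: cM)
  have degM: "degree M = 2 * d"
  proof (rule antisym)
    show "degree M \<le> 2 * d"
      using H(1) d by (intro degree_le) (auto simp: cM coeff_eq_0)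
    show "2 * d \<le> degree M"
      by (rule le_degree) (use Hd in \<open>simp add: cMd\<close>)
  qed
  have M0: "M \<noteq> 0" using degM d by auto
  have degMj: "degree (coeff M j) \<le> 2 * d" for j
    unfolding cM using H(1) degree_monom_le[of "coeff H j" d]
    by (intro degree_diff_le) auto
  obtain G \<delta> \<alpha> \<beta> where GM: "G dvd M" and GN: "G dvd N" and \<delta>: "\<delta> \<noteq> 0"
    and comb: "smult \<delta> G = \<alpha> * M + \<beta> * N"
    using bezout_up_to_content[OF M0] by blast
  obtain q where q: "M = G * q" using GM by (elim dvdE)
  define m where "m = degree G"
  \<comment> \<open>The extreme coefficients of \<open>M\<close> in \<open>Z\<close> are monomials
    in \<open>z\<close>, hence so are those of its divisor \<open>G\<close>.\<close>
  have "coeff G 0 * coeff q 0 = monom (coeff H 0) d" using cM0 unfolding q coeff_mult_0 .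
  from monom_factor[OF this H0] obtain c l where c: "c \<noteq> 0" and G0: "coeff G 0 = monom c l" by blast
  have "coeff G m * lead_coeff q = monom (coeff H (2 * d)) d"
    using cMd unfolding degM[symmetric] m_def q by (simp only: lead_coeff_mult)
  from monom_factor[OF this Hd] obtain a k where a: "a \<noteq> 0" and kd: "k \<le> d" and Gm: "coeff G m = monom a k"
    by blast
  have eG0: "eval_inner z G \<noteq> 0" if "z \<noteq> 0" for z
  proof
    assume "eval_inner z G = 0"
    then have "coeff (eval_inner z G) m = 0" by simp
    then show False using that a by (simp add: Gm poly_monom)
  qed

  \<comment> \<open>At paired points \<open>M\<close> and \<open>N\<close> specialise to proportional polynomials in \<open>Z\<close>, so \<open>G\<close> does too.\<close>
  have assoc: "\<forall>\<^sub>F x in F. \<exists>s. s \<noteq> 0 \<and>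
      eval_inner (cis (\<theta>2 x)) G = smult s (eval_inner (cis (\<theta>1 x)) G)"
    using generic1[OF \<delta>] generic2[OF \<delta>] generic1[OF F2(3)] generic2[OF F2(3)]
      inv[unfolded invariant_def] cross
  proof eventually_elim
    case (elim x)
    define z w where "z = cis (\<theta>1 x)" and "w = cis (\<theta>2 x)"
    have nz: "z \<noteq> 0" "w \<noteq> 0" by (auto simp: z_def w_def)
    have "D w = smult (w ^ d / z ^ d) (D z)"
      using elim(5) nz H(2)[of "\<theta>1 x"] H(2)[of "\<theta>2 x"]
      unfolding D_def by (simp add: z_def w_def smult_diff_right smult_monom flip: H(2))
    from smult_imp_associated[OF this] nz have D: "D z dvd D w" "D w dvd D z" by simp_all
    have f2: "f2 (\<theta>1 x) \<noteq> 0" "f2 (\<theta>2 x) \<noteq> 0"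
      using elim(3,4) by (auto simp flip: F2(2))
    define s where "s = complex_of_real (f2 (\<theta>2 x) / f2 (\<theta>1 x))"
    have s: "s \<noteq> 0" using f2 by (simp add: s_def)
    have "poly F2 w = (s * w ^ n / z ^ n) * poly F2 z"
      using f2 nz unfolding z_def w_def F2(2)[symmetric] s_def by simp
    moreover have "poly F1 w = (s * w ^ n / z ^ n) * poly F1 z"
    proof -
      have "f1 (\<theta>2 x) = f2 (\<theta>2 x) / f2 (\<theta>1 x) * f1 (\<theta>1 x)"
        using elim(6) f2 by (simp add: field_simps)
      then have "complex_of_real (f1 (\<theta>2 x)) = s * f1 (\<theta>1 x)" unfolding s_def by (metis of_real_mult)
      then show ?thesis using nz unfolding z_def w_def F1(2)[symmetric] by simp
    qed
    ultimately have "C w = smult (s * w ^ n / z ^ n) (C z)"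
      unfolding C_def by (simp add: smult_diff_right)
    from smult_imp_associated[OF this] nz s have C: "C z dvd C w" "C w dvd C z" by simp_all
    have "eval_inner z G dvd eval_inner w G"
      using eval_inner_dvd[OF GM, of z] eval_inner_dvd[OF GN, of z] D C elim(2) unfolding eM eN
      by (intro dvd_eval_gcd[OF comb]) (auto simp: eM eN w_def intro: dvd_trans)
    moreover have "eval_inner w G dvd eval_inner z G"
      using eval_inner_dvd[OF GM, of w] eval_inner_dvd[OF GN, of w] D C elim(1) unfolding eM eN
      by (intro dvd_eval_gcd[OF comb]) (auto simp: eM eN z_def intro: dvd_trans)
    ultimately show ?case using associated_imp_smult eG0[OF nz(2)] unfolding z_def w_def by blast
  qed

  have cross_G: "\<forall>\<^sub>F x in F. poly (coeff G i) (cis (\<theta>2 x)) * poly (coeff G j) (cis (\<theta>1 x)) =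
      poly (coeff G i) (cis (\<theta>1 x)) * poly (coeff G j) (cis (\<theta>2 x))" for i j
    using assoc
  proof eventually_elim
    case (elim x)
    then obtain s where "eval_inner (cis (\<theta>2 x)) G = smult s (eval_inner (cis (\<theta>1 x)) G)" by blast
    then have "poly (coeff G r) (cis (\<theta>2 x)) = s * poly (coeff G r) (cis (\<theta>1 x))" for r
      by (metis coeff_eval_inner coeff_smult)
    then show ?case by simp
  qed

  \<comment> \<open>Comparing the extreme coefficients of \<open>G\<close> at a pair, unequal
    exponents would make a positive power of \<open>cis\<close> invariant, against
    \<open>ratio\<close>.\<close>
  have kl: "k = l"
  proof (rule ccontr)
    assume "k \<noteq> l"
    then have "0 < max k l - min k l" by auto
    from ratio[OF this] cross_G[of 0 m] have "\<forall>\<^sub>F x in F. False"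
    proof eventually_elim
      case (elim x)
      define z w where "z = cis (\<theta>1 x)" and "w = cis (\<theta>2 x)"
      have nz: "z \<noteq> 0" "w \<noteq> 0" by (auto simp: z_def w_def)
      have "w ^ l * z ^ k = z ^ l * w ^ k"
        using elim(2) a c unfolding G0 Gm poly_monom z_def w_def by simp
      then have "z ^ (max k l - min k l) = w ^ (max k l - min k l)"
        using nz by (cases "k \<le> l") (simp_all add: power_diff field_simps)
      then show ?case using elim(1) by (simp add: z_def w_def)
    qed
    then show False using nontrivial by (simp add: eventually_False)
  qed

  \<comment> \<open>On the unit circle both \<open>D z\<close> and \<open>C z\<close> are self-reciprocal up to a constant, hence so is
    their common divisor \<open>G\<close>.\<close>
  have reflect_at: "poly (coeff G j) (cis t) * cnj c = a * cis t ^ (2 * k) * cnj (poly (coeff G (m - j)) (cis t))"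
    if jm: "j \<le> m" and \<delta>t: "poly \<delta> (cis t) \<noteq> 0" for j t
  proof -
    define z where "z = cis t"
    have nz: "z \<noteq> 0" by (simp add: z_def)
    define g where "g = eval_inner z G"
    have g0: "coeff g 0 \<noteq> 0" using c nz by (simp add: g_def G0 poly_monom)
    have "degree g \<le> m" unfolding g_def m_def by (rule degree_le) (simp add: coeff_eq_0)
    moreover have "coeff g m \<noteq> 0" using a nz by (simp add: g_def Gm poly_monom)
    ultimately have dg: "degree g = m" using le_degree by (meson antisym)
    have dD: "degree (D z) \<le> 2 * d"
      unfolding D_def using H(1) degree_monom_le[of "poly H z" d]
      by (intro degree_diff_le order_trans[OF degree_smult_le]) auto
    have dC: "degree (C z) \<le> 2 * n"
      unfolding C_def using F1(1) F2(1) by (intro degree_diff_le order_trans[OF degree_smult_le])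
    have "poly (D z) (cis s) = z ^ d * complex_of_real (h s - h t) * cis s ^ d" for s
      unfolding D_def z_def by (simp add: poly_monom algebra_simps flip: H(2))
    from self_reflect_dvd[OF dD this] have RD: "conj_reflect (2 * d) (D z) dvd D z" .
    have "poly (C z) (cis s) = z ^ n * complex_of_real (f2 t * f1 s - f1 t * f2 s) * cis s ^ n" for s
      unfolding C_def z_def by (simp add: algebra_simps flip: F1(2) F2(2))
    from self_reflect_dvd[OF dC this] have RC: "conj_reflect (2 * n) (C z) dvd C z" .
    have "conj_reflect m g dvd D z"
      using conj_reflect_dvd[of g "D z", OF _ dD] eval_inner_dvd[OF GM, of z] RD dg
      unfolding eM g_def by (auto intro: dvd_trans)
    moreover have "conj_reflect m g dvd C z"
      using conj_reflect_dvd[of g "C z", OF _ dC] eval_inner_dvd[OF GN, of z] RC dg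
      unfolding eN g_def by (auto intro: dvd_trans)
    ultimately have "conj_reflect m g dvd g"
      unfolding g_def using \<delta>t by (intro dvd_eval_gcd[OF comb]) (simp_all add: eM eN z_def)
    then obtain r where r: "g = conj_reflect m g * r" by (elim dvdE)
    \<comment> \<open>Since \<open>g\<close> does not vanish at 0, its reflection keeps the full
      degree \<open>m\<close>, and the cofactor \<open>r\<close> must be constant.\<close>
    have "coeff (conj_reflect m g) m \<noteq> 0" using g0 by (simp add: coeff_conj_reflect)
    then have "m \<le> degree (conj_reflect m g)" by (rule le_degree)
    moreover have "m = degree (conj_reflect m g) + degree r"
    proof -
      have "g \<noteq> 0" using g0 by auto
      then have "conj_reflect m g \<noteq> 0" "r \<noteq> 0" using r by (metis mult_zero_left mult_zero_right)+
      then show ?thesis using r dg by (metis degree_mult_eq)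
    qed
    ultimately have "degree r = 0" by simp
    then obtain s where "r = [:s:]" by (rule degree_eq_zeroE)
    then have "g = smult s (conj_reflect m g)" using r by simp
    then have co: "coeff g i = s * cnj (coeff g (m - i))" if "i \<le> m" for i
      using that by (metis coeff_smult coeff_conj_reflect)
    have zz: "z ^ k * cnj (z ^ k) = 1" by (simp add: z_def cis_cnj cis_mult flip: power_mult_distrib)
    \<comment> \<open>The top coefficient determines the constant \<open>s\<close>; here
      \<open>k = l\<close> enters.\<close>
    have "a * z ^ k = s * cnj (c * z ^ k)"
      using co[of m] by (simp add: g_def Gm G0 poly_monom kl)
    then have "a * (z ^ k * z ^ k) = s * cnj c * (z ^ k * cnj (z ^ k))" by simp
    then have "s * cnj c = a * z ^ (2 * k)" unfolding zz by (simp add: mult_2 power_add)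
    then show ?thesis using co[OF jm] unfolding g_def z_def[symmetric]
      by simp
  qed

  have deg_coeff: "degree (coeff G j) \<le> 2 * k" for j
  proof (cases "j \<le> m \<and> coeff G j \<noteq> 0")
    case True
    \<comment> \<open>The bound \<open>2 * k\<close> is not yet available as a formal degree, so the
      reflection is taken with respect to the actual degree \<open>e\<close>, and the surplus
      \<open>z ^ e\<close> cancels in the count.\<close>
    define e where "e = degree (coeff G (m - j))"
    have "smult (cnj c) (monom 1 e * coeff G j) = smult a (monom 1 (2 * k) * conj_reflect e (coeff G (m - j)))"
    proof (rule poly_eq_on_circle_generic[OF \<delta>])
      fix t assume "poly \<delta> (cis t) \<noteq> 0"
      from reflect_at[OF _ this, of j] True
      show "poly (smult (cnj c) (monom 1 e * coeff G j)) (cis t) =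
          poly (smult a (monom 1 (2 * k) * conj_reflect e (coeff G (m - j)))) (cis t)"
        using poly_conj_reflect_circle[of "coeff G (m - j)" e "cis t"]
        by (simp add: e_def poly_monom mult_ac)
    qed
    then have "degree (smult (cnj c) (monom 1 e * coeff G j)) \<le> 2 * k + e"
      using degree_mult_le[of "monom 1 (2 * k)" "conj_reflect e (coeff G (m - j))"]
        degree_monom_le[of "1 :: complex" "2 * k"] degree_conj_reflect[of e "coeff G (m - j)"]
        degree_smult_le[of a "monom 1 (2 * k) * conj_reflect e (coeff G (m - j))"]
      by simp
    moreover have "degree (smult (cnj c) (monom 1 e * coeff G j)) = e + degree (coeff G j)"
      using c True by (simp add: degree_mult_eq degree_monom_eq)
    ultimately show ?thesis by simp
  next
    case False
    then show ?thesis using coeff_eq_0[of G j] unfolding m_def by (cases "j \<le> degree G") auto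
  qed

  have reflect: "smult (cnj c) (coeff G j) = smult a (conj_reflect (2 * k) (coeff G (m - j)))"
    if "j \<le> m" for j
  proof (rule poly_eq_on_circle_generic[OF \<delta>])
    fix t assume "poly \<delta> (cis t) \<noteq> 0"
    from reflect_at[OF that this]
    show "poly (smult (cnj c) (coeff G j)) (cis t) =
        poly (smult a (conj_reflect (2 * k) (coeff G (m - j)))) (cis t)"
      using poly_conj_reflect_circle[OF deg_coeff, of "cis t" "m - j"] by (simp add: mult_ac)
  qed

  \<comment> \<open>The top coefficient of \<open>G\<close> is \<open>a * z ^ k\<close>, so after
    division by \<open>z ^ k\<close> proportionality at a pair becomes equality. The values 1 and
    \<open>- \<i>\<close> of \<open>u\<close> give real and imaginary parts.\<close>
  have inv_coeff: "invariant (\<lambda>t. Re (u * (poly (coeff G j) (cis t) / cis t ^ k)))" for u j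
    unfolding invariant_def using cross_G[of j m]
  proof eventually_elim
    case (elim x)
    then have "poly (coeff G j) (cis (\<theta>2 x)) / cis (\<theta>2 x) ^ k = poly (coeff G j) (cis (\<theta>1 x)) / cis (\<theta>1 x) ^ k"
      using a unfolding Gm poly_monom by (simp add: field_simps)
    then show ?case by simp
  qed

  \<comment> \<open>Otherwise all quotients \<open>coeff G j / z ^ k\<close> are invariant of degree below \<open>d\<close>, hence constant;
    but \<open>G\<close> vanishes on the diagonal \<open>Z = z\<close>.\<close>
  have ex_top: "\<exists>j. coeff (coeff G j) (2 * d) \<noteq> 0"
  proof (rule ccontr)
    assume "\<nexists>j. coeff (coeff G j) (2 * d) \<noteq> 0"
    then have top: "coeff (coeff G j) (2 * d) = 0" for j by blast
    have "trig_degree_le (d - 1) (\<lambda>t. Re (u * (poly (coeff G j) (cis t) / cis t ^ k)))" for u j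
    proof (cases "k < d")
      case True
      have "degree (smult u (coeff G j)) \<le> 2 * k"
        using deg_coeff[of j] degree_smult_le[of u "coeff G j"] by simp
      from trig_degree_le_Re[OF this]
      have "trig_degree_le k (\<lambda>t. Re (u * (poly (coeff G j) (cis t) / cis t ^ k)))"
        by (simp only: poly_smult times_divide_eq_right)
      then show ?thesis by (rule trig_degree_le_mono) (use True in simp)
    next
      case False
      then have "k = d" using kd by simp
      \<comment> \<open>For \<open>k = d\<close>, \<open>reflect\<close> carries the vanishing
        coefficients at \<open>2 * d\<close> to the constant ones, so the degree drops to
        \<open>d - 1\<close>.\<close>
      have "coeff (coeff G j) 0 = 0"
      proof (cases "j \<le> m")
        case True
        have "cnj c * coeff (coeff G j) 0 = a * cnj (coeff (coeff G (m - j)) (2 * k))"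
          using arg_cong[OF reflect[OF True], of "\<lambda>p. coeff p 0"] by (simp add: coeff_conj_reflect)
        then show ?thesis using top c \<open>k = d\<close> by simp
      next
        case False
        then show ?thesis unfolding m_def by (simp add: coeff_eq_0)
      qed
      from degree_drop_ends[OF _ this top d] deg_coeff[of j] \<open>k = d\<close>
      obtain p where p: "coeff G j = pCons 0 p" "degree p \<le> 2 * (d - 1)" by auto
      have "degree (smult u p) \<le> 2 * (d - 1)" using p(2) degree_smult_le[of u p] by simp
      from trig_degree_le_Re[OF this]
      have "trig_degree_le (d - 1) (\<lambda>t. Re (u * (poly p (cis t) / cis t ^ (d - 1))))"
        by (simp only: poly_smult times_divide_eq_right)
      moreover have "poly (coeff G j) (cis t) / cis t ^ k = poly p (cis t) / cis t ^ (d - 1)" for t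
        using d unfolding \<open>k = d\<close> p(1) by (cases d) simp_all
      ultimately show ?thesis by (simp only:)
    qed
    from least[OF this inv_coeff]
    have const: "\<exists>v. \<forall>t. Re (u * (poly (coeff G j) (cis t) / cis t ^ k)) = v" for u j .
    have "poly (coeff G j) (cis t) / cis t ^ k = poly (coeff G j) 1" for j t
    proof (rule complex_eqI)
      show "Re (poly (coeff G j) (cis t) / cis t ^ k) = Re (poly (coeff G j) 1)"
        using const[of 1 j] by (metis cis_zero div_by_1 mult_1 power_one)
      have "Re (- \<i> * (poly (coeff G j) (cis t) / cis t ^ k)) = Re (- \<i> * (poly (coeff G j) 1))"
        using const[of "- \<i>" j] by (metis cis_zero div_by_1 power_one)
      moreover have "Re (- \<i> * v) = Im v" for v by simp
      ultimately show "Im (poly (coeff G j) (cis t) / cis t ^ k) = Im (poly (coeff G j) 1)" by (simp only:)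
    qed
    then have "poly (coeff G j) (cis t) = cis t ^ k * poly (coeff G j) 1" for j t
      by (simp add: field_simps)
    then have eq: "eval_inner (cis t) G = smult (cis t ^ k) (eval_inner 1 G)" for t
      by (simp add: poly_eq_iff)
    \<comment> \<open>Where \<delta> is nonzero, \<open>Z = z\<close> is a common root of
      \<open>D z\<close> and \<open>C z\<close>, so this one polynomial vanishes at almost all
      points of the circle.\<close>
    have "eval_inner 1 G = 0"
    proof (rule poly_eq_on_circle_generic[OF \<delta>])
      fix t assume "poly \<delta> (cis t) \<noteq> 0"
      then have "[:- cis t, 1:] dvd eval_inner (cis t) G"
        by (rule dvd_eval_gcd[OF comb]) (simp_all add: eM eN D_def C_def poly_monom flip: poly_eq_0_iff_dvd)
      then have "poly (smult (cis t ^ k) (eval_inner 1 G)) (cis t) = 0"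
        unfolding eq poly_eq_0_iff_dvd .
      then show "poly (eval_inner 1 G) (cis t) = poly 0 (cis t)" by simp
    qed
    then show False using eG0[of 1] by simp
  qed

  then obtain j0 where j0: "coeff (coeff G j0) (2 * d) \<noteq> 0" by blast
  define q' where "q' = eval_inner 0 q"
  have "degree (coeff q j) = 0" for j
    by (rule inner_degree_cofactor[of G q "2 * d" j0]) (use degMj j0 q in auto)
  then have "coeff q j = [:poly (coeff q j) 0:]" for j
    by (metis degree_eq_zeroE poly_pCons mult_zero_left add.right_neutral)
  then have "poly (coeff q j) z = poly (coeff q j) 0" for j z
    by (metis poly_pCons mult_zero_right add.right_neutral poly_0)
  then have "eval_inner z q = q'" for z by (simp add: poly_eq_iff q'_def)
  then have Dq: "D z = eval_inner z G * q'" for z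
    using eM[of z] unfolding q eval_inner_mult by simp
  have "degree q' = 0"
  proof (rule ccontr)
    assume "degree q' \<noteq> 0"
    then obtain Z where Z: "poly q' Z = 0"
      using fundamental_theorem_of_algebra[of q'] constant_degree[of q'] by auto
    \<comment> \<open>Such a \<open>Z\<close> would give
      \<open>monom (poly H Z) d = smult (Z ^ d) H\<close>; the constant coefficients force
      \<open>Z = 0\<close>, and then \<open>coeff H 0 = 0\<close>.\<close>
    have "poly (D z) Z = 0" for z unfolding Dq using Z by simp
    then have "poly (monom (poly H Z) d - smult (Z ^ d) H) z = 0" for z
      by (simp add: D_def poly_monom mult_ac)
    then have eq: "monom (poly H Z) d = smult (Z ^ d) H"
      using poly_all_0_iff_0[of "monom (poly H Z) d - smult (Z ^ d) H"] by simp
    from arg_cong[OF this, of "\<lambda>p. coeff p 0"] have "Z = 0" using d H0 by simp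
    with eq d H0 show False by (simp add: poly_0_coeff_0 zero_power)
  qed
  then obtain s where s: "q' = [:s:]" by (rule degree_eq_zeroE)
  have "D 1 \<noteq> 0"
  proof
    assume "D 1 = 0"
    then have "coeff (D 1) 0 = 0" by simp
    then show False using d H0 by (simp add: D_def)
  qed
  then have "s \<noteq> 0" using Dq[of 1] s by auto
  then have "D z0 dvd eval_inner z0 G" using Dq[of z0] s by (simp add: smult_dvd_iff)
  also have "eval_inner z0 G dvd C z0" using eval_inner_dvd[OF GN, of z0] eN by simp
  finally show ?thesis unfolding D_def C_def .
qed

end

section \<open>Repeated division by \<open>h - h t0\<close>\<close>

locale minimal_invariant = point_pairs F \<theta>1 \<theta>2
  for F :: "'i filter" and \<theta>1 \<theta>2 :: "'i \<Rightarrow> real" +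
  fixes h :: "real \<Rightarrow> real" and d :: nat and H :: "complex poly"
  assumes degree_H: "degree H \<le> 2 * d"
    and poly_H: "complex_of_real (h t) * cis t ^ d = poly H (cis t)"
    and inv_h: "invariant h" and d_pos: "0 < d"
    and H_0: "coeff H 0 \<noteq> 0" and H_top: "coeff H (2 * d) \<noteq> 0"
    and least: "trig_degree_le (d - 1) g \<Longrightarrow> invariant g \<Longrightarrow> \<exists>c. \<forall>t. g t = c"
begin

text \<open>Invariance of \<open>f / g\<close> in a form free of division.\<close>

definition cross :: "(real \<Rightarrow> real) \<Rightarrow> (real \<Rightarrow> real) \<Rightarrow> bool" where
  "cross f g \<longleftrightarrow> (\<forall>\<^sub>F x in F. f (\<theta>1 x) * g (\<theta>2 x) = f (\<theta>2 x) * g (\<theta>1 x))"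

lemma trig_degree_h: "trig_degree_le d h"
  unfolding trig_degree_le_def using degree_H poly_H by blast

lemma h_neq: "\<forall>\<^sub>F x in F. h (\<theta>1 x) \<noteq> v"
proof -
  have "coeff (H - monom (of_real v) d) 0 \<noteq> 0" using H_0 d_pos by simp
  then have "H - monom (of_real v) d \<noteq> 0" by (metis coeff_0)
  from generic1[OF this] show ?thesis
    by eventually_elim (auto simp: poly_monom simp flip: poly_H)
qed

text \<open>This is \<open>minimal_invariant_dvd\<close> at \<open>z0 = cis t0\<close>: the
  combination of \<open>f\<close> and \<open>g\<close> vanishing at \<open>t0\<close> is divisible
  by \<open>h - h t0\<close>, and the quotient inherits the cross relation.\<close>

lemma cross_step:
  assumes f: "trig_degree_le n f" and g: "trig_degree_le n g" and "cross f g" and t0: "g t0 \<noteq> 0"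
    and "d \<le> n"
  shows "\<exists>e. trig_degree_le (n - d) e \<and> cross e g \<and>
      (\<forall>t. f t = f t0 / g t0 * g t + (h t - h t0) * e t)"
proof -
  obtain F1 where F1: "degree F1 \<le> 2 * n" "\<And>t. complex_of_real (f t) * cis t ^ n = poly F1 (cis t)"
    using f unfolding trig_degree_le_def by blast
  obtain F2 where F2: "degree F2 \<le> 2 * n" "\<And>t. complex_of_real (g t) * cis t ^ n = poly F2 (cis t)"
    using g unfolding trig_degree_le_def by blast
  have F2nz: "F2 \<noteq> 0"
  proof
    assume "F2 = 0"
    then show False using F2(2)[of t0] t0 by simp
  qed
  let ?z = "cis t0"
  define D where "D = smult (?z ^ d) H - monom (poly H ?z) d"
  have "D dvd smult (poly F2 ?z) F1 - smult (poly F1 ?z) F2"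
    unfolding D_def
    by (rule minimal_invariant_dvd[OF degree_H poly_H inv_h d_pos H_0 H_top least F1 F2 F2nz])
      (use \<open>cross f g\<close> in \<open>simp_all add: cross_def\<close>)
  then obtain S where S: "smult (poly F2 ?z) F1 - smult (poly F1 ?z) F2 = D * S" by (elim dvdE)
  have "coeff D (2 * d) \<noteq> 0" using d_pos H_top by (simp add: D_def)
  then have D: "2 * d \<le> degree D" "D \<noteq> 0" by (auto intro: le_degree)
  have degS: "degree S \<le> 2 * (n - d)"
  proof (cases "S = 0")
    case False
    have "degree (D * S) \<le> 2 * n"
      unfolding S[symmetric] using F1(1) F2(1)
      by (intro degree_diff_le order_trans[OF degree_smult_le])
    then show ?thesis using D False by (simp add: degree_mult_eq)
  qed simp
  \<comment> \<open>\<open>S\<close> is the quotient of the cleared forms; \<open>u\<close> removes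
    the factors that depend on \<open>t0\<close> alone.\<close>
  define u where "u = 1 / (complex_of_real (g t0) * ?z ^ (n - d))"
  define e where "e = (\<lambda>t. Re (poly (smult u S) (cis t) / cis t ^ (n - d)))"
  have 1: "trig_degree_le (n - d) e"
    unfolding e_def by (rule trig_degree_le_Re) (use degS degree_smult_le[of u S] in simp)
  have 2: "f t = f t0 / g t0 * g t + (h t - h t0) * e t" for t
  proof -
    let ?w = "cis t"
    have split: "?z ^ n = ?z ^ d * ?z ^ (n - d)" "?w ^ n = ?w ^ d * ?w ^ (n - d)"
      using \<open>d \<le> n\<close> by (simp_all flip: power_add)
    have "?z ^ n * ?w ^ n * complex_of_real (g t0 * f t - f t0 * g t) =
        ?z ^ d * ?w ^ d * complex_of_real (h t - h t0) * poly S ?w"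
      using arg_cong[OF S, of "\<lambda>p. poly p ?w"]
      by (simp add: D_def poly_monom algebra_simps flip: F1(2) F2(2) poly_H)
    then have "?z ^ (n - d) * ?w ^ (n - d) * complex_of_real (g t0 * f t - f t0 * g t) =
        complex_of_real (h t - h t0) * poly S ?w"
      unfolding split by (simp add: mult.assoc mult.left_commute[of _ "?w ^ d"])
    then have "complex_of_real (h t - h t0) * (u * poly S ?w / ?w ^ (n - d)) =
        complex_of_real (g t0 * f t - f t0 * g t) / complex_of_real (g t0)"
      unfolding u_def using t0 by (simp add: divide_simps) (simp add: mult_ac)
    also have "\<dots> = complex_of_real (f t - f t0 / g t0 * g t)"
      using t0 by (simp add: field_simps)
    finally have "Re (complex_of_real (h t - h t0) * (u * poly S ?w / ?w ^ (n - d))) = f t - f t0 / g t0 * g t"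
      by (simp only: Re_complex_of_real)
    then have "(h t - h t0) * e t = f t - f t0 / g t0 * g t"
      unfolding e_def poly_smult Re_complex_of_real times_complex.sel(1)[of "complex_of_real _"]
      by simp
    then show ?thesis by simp
  qed
  \<comment> \<open>The factor \<open>h - h t0\<close> agrees at both points of a pair and is
    eventually nonzero there, so it cancels.\<close>
  have "cross e g"
    unfolding cross_def using h_neq[of "h t0"] \<open>cross f g\<close>[unfolded cross_def] inv_h[unfolded invariant_def]
  proof eventually_elim
    case (elim x)
    let ?s = "\<theta>1 x" and ?t = "\<theta>2 x"
    have "(h ?s - h t0) * (e ?s * g ?t) = (f ?s - f t0 / g t0 * g ?s) * g ?t"
      using 2[of ?s] by simp
    also have "\<dots> = (f ?t - f t0 / g t0 * g ?t) * g ?s"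
      using elim(2) by (simp add: algebra_simps)
    also have "\<dots> = (h ?s - h t0) * (e ?t * g ?s)"
      using 2[of ?t] elim(3) by simp
    finally show ?case using elim(1) by simp
  qed
  then show ?thesis using 1 2 by blast
qed

text \<open>Each division lowers the degree bound by \<open>d\<close>. What remains below
  \<open>d\<close> is left to \<open>base\<close>, which has different proofs for
  \<open>g = 1\<close> and for the derivative of \<open>h\<close>.\<close>

lemma cross_imp_poly_multiple:
  assumes g: "trig_degree_le d g" and t0: "g t0 \<noteq> 0"
    and base: "\<And>f. trig_degree_le (d - 1) f \<Longrightarrow> cross f g \<Longrightarrow> \<exists>c. \<forall>t. f t = c * g t"
  shows "trig_degree_le n f \<Longrightarrow> cross f g \<Longrightarrow> \<exists>Q. \<forall>t. f t = poly Q (h t) * g t"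
proof (induction n arbitrary: f rule: less_induct)
  case (less n)
  show ?case
  proof (cases "n < d")
    case True
    then have "trig_degree_le (d - 1) f" by (intro trig_degree_le_mono[OF less.prems(1)]) simp
    from base[OF this less.prems(2)] obtain c where "\<forall>t. f t = c * g t" ..
    then show ?thesis by (intro exI[of _ "[:c:]"]) simp
  next
    case False
    then have dn: "d \<le> n" by simp
    obtain e where e: "trig_degree_le (n - d) e" "cross e g"
      "\<And>t. f t = f t0 / g t0 * g t + (h t - h t0) * e t"
      using cross_step[OF less.prems(1) trig_degree_le_mono[OF g dn] less.prems(2) t0 dn] by blast
    have "n - d < n" using d_pos dn by simp
    from less.IH[OF this e(1,2)] obtain Q where Q: "\<And>t. e t = poly Q (h t) * g t" by blast
    have "f t = poly ([:f t0 / g t0:] + [:- h t0, 1:] * Q) (h t) * g t" for t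
      unfolding e(3)[of t] Q by (simp add: algebra_simps)
    then show ?thesis by blast
  qed
qed

lemma invariant_imp_poly:
  assumes "trig_degree_le n f" "invariant f"
  shows "\<exists>P. \<forall>t. f t = poly P (h t)"
proof -
  have "\<exists>Q. \<forall>t. f t = poly Q (h t) * (\<lambda>_. 1) t"
    by (rule cross_imp_poly_multiple[OF trig_degree_le_const _ _ assms(1)])
      (use least assms(2) in \<open>simp_all add: cross_def invariant_def\<close>)
  then show ?thesis by simp
qed

lemma h_not_const: "\<not> (\<forall>t. h t = c)"
proof
  assume *: "\<forall>t. h t = c"
  have "H = monom (of_real c) d"
    by (rule poly_eq_on_circle) (simp add: * poly_monom flip: poly_H)
  then show False using H_0 d_pos by simp
qed

context
  fixes h' assumes deriv_h: "\<And>t. (h has_real_derivative h' t) (at t)"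
    and trig_h': "trig_degree_le d h'"
begin

lemma h'_nonzero: "\<exists>t. h' t \<noteq> 0"
proof (rule ccontr)
  assume "\<nexists>t. h' t \<noteq> 0"
  then have "(h has_real_derivative 0) (at t)" for t using deriv_h[of t] by simp
  then have "h t = h 0" for t using DERIV_isconst_all[of h t 0] by blast
  then show False using h_not_const by blast
qed

text \<open>If the derivative of \<open>h\<close> were invariant it would be an affine function of \<open>h\<close>, and then
  the square of \<open>h'\<close> would have a periodic antiderivative.\<close>

lemma h'_not_invariant: "\<not> invariant h'"
proof
  assume "invariant h'"
  then have "cross h' (\<lambda>_. 1)" by (simp add: cross_def invariant_def)
  from cross_step[OF trig_h' trig_degree_le_const this, of 0]
  obtain e where e: "trig_degree_le 0 e" and eq: "\<And>t. h' t = h' 0 + (h t - h 0) * e t" by auto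
  obtain s where s: "\<And>t. e t = s" using e unfolding trig_degree_le_iff by auto
  define r where "r = h' 0 - h 0 * s"
  have h': "h' t = r + s * h t" for t using eq[of t] by (simp add: s r_def algebra_simps)
  define \<phi> where "\<phi> t = r * h t + s * (h t)\<^sup>2 / 2" for t
  have d\<phi>: "(\<phi> has_real_derivative (h' t)\<^sup>2) (at t)" for t
  proof -
    have "(\<phi> has_real_derivative (r * h' t + s * h t * h' t)) (at t)"
      unfolding \<phi>_def by (rule derivative_eq_intros deriv_h refl | simp)+
    then show ?thesis by (rule DERIV_cong) (simp add: h' power2_eq_square algebra_simps)
  qed
  have mono: "\<phi> t \<le> \<phi> t'" if "t \<le> t'" for t t'
    by (rule DERIV_nonneg_imp_nondecreasing[OF that]) (use d\<phi> in fastforce)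
  obtain t where "h' t \<noteq> 0" using h'_nonzero by blast
  then have "0 < (h' t)\<^sup>2" by simp
  from DERIV_pos_inc_right[OF d\<phi> this] obtain \<epsilon> where \<epsilon>: "\<epsilon> > 0" "\<And>e. e > 0 \<Longrightarrow> e < \<epsilon> \<Longrightarrow> \<phi> t < \<phi> (t + e)"
    by blast
  define e' where "e' = min (\<epsilon> / 2) (2 * pi)"
  have "0 < e'" "e' < \<epsilon>" "t + e' \<le> t + 2 * pi" using \<epsilon>(1) by (auto simp: e'_def)
  then have "\<phi> t < \<phi> (t + 2 * pi)" using \<epsilon>(2)[of e'] mono[of "t + e'" "t + 2 * pi"] by linarith
  moreover have "\<phi> (t + 2 * pi) = \<phi> t"
    by (simp add: \<phi>_def trig_degree_le_periodic[OF trig_degree_h])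
  ultimately show False by simp
qed

text \<open>In the base case \<open>f\<close> is divided as a function of degree \<open>d\<close>.
  The quotient is a constant, and a nonzero constant in its cross relation with \<open>h'\<close>
  would make \<open>h'\<close> invariant.\<close>

lemma cross_h'_imp_poly:
  assumes "trig_degree_le n b" "cross b h'"
  shows "\<exists>Q. \<forall>t. b t = poly Q (h t) * h' t"
proof -
  obtain t0 where t0: "h' t0 \<noteq> 0" using h'_nonzero by blast
  show ?thesis
  proof (rule cross_imp_poly_multiple[OF trig_h' t0 _ assms])
    fix f assume f: "trig_degree_le (d - 1) f" "cross f h'"
    have "trig_degree_le d f" by (rule trig_degree_le_mono[OF f(1)]) simp
    from cross_step[OF this trig_h' f(2) t0]
    obtain e where e: "trig_degree_le 0 e" "cross e h'"
      and eq: "\<And>t. f t = f t0 / h' t0 * h' t + (h t - h t0) * e t" by auto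
    obtain s where s: "\<And>t. e t = s" using e(1) unfolding trig_degree_le_iff by auto
    have "s = 0"
    proof (rule ccontr)
      assume "s \<noteq> 0"
      with e(2) have "invariant h'" unfolding cross_def invariant_def s
        by (auto elim!: eventually_mono)
      then show False using h'_not_invariant by simp
    qed
    then have "f t = f t0 / h' t0 * h' t" for t using eq[of t] s[of t] by simp
    then show "\<exists>c. \<forall>t. f t = c * h' t" by blast
  qed
qed

end

end

context point_pairs
begin

lemma minimal_invariant_exists:
  assumes "trig_degree_le n A" "invariant A" "\<nexists>c. \<forall>t. A t = c"
  shows "\<exists>h d H. minimal_invariant F \<theta>1 \<theta>2 h d H"
proof -
  define good where "good k \<longleftrightarrow> (\<exists>f. trig_degree_le k f \<and> invariant f \<and> (\<nexists>c. \<forall>t. f t = c))" for k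
  define d where "d = (LEAST k. good k)"
  have "good n" using assms unfolding good_def by blast
  then have "good d" unfolding d_def by (rule LeastI)
  then obtain h where h: "trig_degree_le d h" "invariant h" and nc: "\<nexists>c. \<forall>t. h t = c"
    unfolding good_def by blast
  have least: "\<exists>c. \<forall>t. g t = c" if "trig_degree_le k g" "invariant g" "k < d" for g k
    using not_less_Least[of k good] that unfolding d_def good_def by blast
  have d: "0 < d"
  proof (rule ccontr)
    assume "\<not> 0 < d"
    then have "trig_degree_le 0 h" using h(1) by simp
    then show False using nc unfolding trig_degree_le_iff by auto
  qed
  obtain H where H: "degree H \<le> 2 * d" "\<And>t. complex_of_real (h t) * cis t ^ d = poly H (cis t)"
    using h(1) unfolding trig_degree_le_def by blast
  have refl: "conj_reflect (2 * d) H = H" by (rule trig_degree_le_reflect[OF H])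
  \<comment> \<open>The extreme coefficients are conjugate, so either both vanish and the degree
    drops, or neither does.\<close>
  have iff: "coeff H 0 = cnj (coeff H (2 * d))"
    using coeff_conj_reflect[of "2 * d" H 0] unfolding refl by simp
  have "coeff H 0 \<noteq> 0"
  proof
    assume "coeff H 0 = 0"
    with iff have "coeff H (2 * d) = 0" by simp
    from degree_drop_ends[OF H(1) \<open>coeff H 0 = 0\<close> this d] obtain p where
      p: "H = pCons 0 p" "degree p \<le> 2 * (d - 1)" by blast
    have "complex_of_real (h t) * cis t ^ (d - 1) = poly p (cis t)" for t
      using H(2)[of t] d unfolding p(1) by (cases d) simp_all
    then have "trig_degree_le (d - 1) h" using p(2) unfolding trig_degree_le_def by blast
    from least[OF this h(2)] d nc show False by simp
  qed
  then have "minimal_invariant F \<theta>1 \<theta>2 h d H"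
    using H h(2) d iff least[of "d - 1"]
    by (intro minimal_invariant.intro minimal_invariant_axioms.intro point_pairs_axioms) auto
  then show ?thesis by blast
qed

text \<open>Invariance gives \<open>A = R(h)\<close>, hence \<open>a = R'(h) h'\<close>. At the
  pairs \<open>h\<close> avoids the finitely many roots of \<open>R'\<close>, so the relation of
  \<open>a\<close> and \<open>b\<close> becomes one of \<open>b\<close> and
  \<open>h'\<close>.\<close>

lemma composition:
  assumes A: "trig_degree_le n A" "\<And>t. (A has_real_derivative a t) (at t)" "invariant A" "\<exists>t. a t \<noteq> 0"
    and b: "trig_degree_le m b"
    and cross: "\<forall>\<^sub>F x in F. a (\<theta>1 x) * b (\<theta>2 x) = a (\<theta>2 x) * b (\<theta>1 x)"
  shows "\<exists>P Q h. trig_poly h \<and> (\<forall>t. a t = poly P (h t) * deriv h t \<and> b t = poly Q (h t) * deriv h t)"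
proof -
  have "\<nexists>c. \<forall>t. A t = c"
  proof
    assume "\<exists>c. \<forall>t. A t = c"
    then obtain c where "A = (\<lambda>t. c)" by auto
    then have "(A has_real_derivative 0) (at t)" for t by simp
    then have "a t = 0" for t using DERIV_unique[OF A(2)] by blast
    then show False using A(4) by simp
  qed
  from minimal_invariant_exists[OF A(1,3) this] obtain h d H where "minimal_invariant F \<theta>1 \<theta>2 h d H" by blast
  then interpret minimal_invariant F \<theta>1 \<theta>2 h d H .
  obtain h' where h': "trig_degree_le d h'" "\<And>t. (h has_real_derivative h' t) (at t)"
    using trig_degree_le_deriv[OF trig_degree_h] by blast
  obtain R where R: "\<And>t. A t = poly R (h t)" using invariant_imp_poly[OF A(1,3)] by blast
  have a: "a t = poly (pderiv R) (h t) * h' t" for t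
  proof (rule DERIV_unique[OF A(2)])
    have "((\<lambda>t. poly R (h t)) has_real_derivative poly (pderiv R) (h t) * h' t) (at t)"
      by (rule DERIV_chain2[OF poly_DERIV h'(2)])
    moreover have "(\<lambda>t. poly R (h t)) = A" using R by auto
    ultimately show "(A has_real_derivative poly (pderiv R) (h t) * h' t) (at t)" by (simp only:)
  qed
  have "pderiv R \<noteq> 0" using A(4) a by auto
  then have "finite {v. poly (pderiv R) v = 0}" by (rule poly_roots_finite)
  then have "\<forall>\<^sub>F x in F. \<forall>v\<in>{v. poly (pderiv R) v = 0}. h (\<theta>1 x) \<noteq> v"
    by (rule eventually_ball_finite) (use h_neq in blast)
  then have "minimal_invariant.cross F \<theta>1 \<theta>2 b h'"
    unfolding cross_def using cross inv_h[unfolded invariant_def]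
  proof eventually_elim
    case (elim x)
    then have "poly (pderiv R) (h (\<theta>2 x)) \<noteq> 0" by auto
    with elim(2,3) show ?case unfolding a by (simp add: algebra_simps)
  qed
  from cross_h'_imp_poly[OF h'(2,1) b this] obtain Q where Q: "\<And>t. b t = poly Q (h t) * h' t" by blast
  have "deriv h t = h' t" for t using h'(2) by (rule DERIV_imp_deriv)
  then show ?thesis
    using trig_degree_le_imp_trig_poly[OF trig_degree_h] a Q by (intro exI[of _ "pderiv R"] exI[of _ Q] exI[of _ h]) simp
qed

end

section \<open>Centers of the piecewise linear equation\<close>

lemma trig_degree_le_bounded:
  assumes "trig_degree_le n f"
  shows "\<exists>K. \<forall>t. \<bar>f t\<bar> \<le> K"
proof -
  obtain c where c: "\<And>t. f t = (\<Sum>j\<le>2*n. Re (c j * cis ((real j - real n) * t)))"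
    using assms unfolding trig_degree_le_iff by blast
  have "\<bar>f t\<bar> \<le> (\<Sum>j\<le>2*n. norm (c j))" for t
    unfolding c by (rule order_trans[OF sum_abs], rule sum_mono)
      (metis abs_Re_le_cmod norm_cis norm_mult mult.right_neutral)
  then show ?thesis by blast
qed

lemma antiderivative_exists:
  fixes f :: "real \<Rightarrow> real"
  assumes "\<And>t. isCont f t"
  shows "\<exists>g. \<forall>t. (g has_real_derivative f t) (at t)"
  using einterval_antiderivative[of "-\<infinity>" "\<infinity>" f] assms
  by (auto simp: has_real_derivative_iff_has_vector_derivative)

definition pl_solution :: "(real \<Rightarrow> real) \<Rightarrow> (real \<Rightarrow> real) \<Rightarrow> (real \<Rightarrow> real) \<Rightarrow> bool" where
  "pl_solution a b v \<longleftrightarrow> (\<forall>t. (v has_real_derivative a t * \<bar>v t\<bar> + b t) (at t))"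

text \<open>Both estimates hold because \<open>(v - w)\<^sup>2 exp (\<minusplus> 2 K t)\<close> is monotone.\<close>

lemma pl_solution_gap:
  assumes v: "pl_solution a b v" and w: "pl_solution a b w" and K: "\<And>t. \<bar>a t\<bar> \<le> K" and t: "0 \<le> t"
  shows "\<bar>v t - w t\<bar> \<le> \<bar>v 0 - w 0\<bar> * exp (K * t)"
    and "\<bar>v 0 - w 0\<bar> * exp (- K * t) \<le> \<bar>v t - w t\<bar>"
proof -
  define D where "D s = v s - w s" for s
  define D' where "D' s = a s * (\<bar>v s\<bar> - \<bar>w s\<bar>)" for s
  have dD: "(D has_real_derivative D' s) (at s)" for s
    unfolding D_def D'_def using v w unfolding pl_solution_def
    by (auto intro!: derivative_eq_intros simp: algebra_simps)
  have DD: "\<bar>D s * D' s\<bar> \<le> K * (D s)\<^sup>2" for s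
  proof -
    have "\<bar>D' s\<bar> \<le> K * \<bar>D s\<bar>"
      unfolding D'_def D_def abs_mult using K[of s] by (intro mult_mono) auto
    then have "\<bar>D s\<bar> * \<bar>D' s\<bar> \<le> \<bar>D s\<bar> * (K * \<bar>D s\<bar>)" by (intro mult_left_mono) auto
    then show ?thesis by (simp add: abs_mult power2_eq_square mult_ac)
  qed
  define E where "E r s = (D s)\<^sup>2 * exp (r * 2 * K * s)" for r s
  have dE: "(E r has_real_derivative (2 * (D s * D' s) + r * 2 * K * (D s)\<^sup>2) * exp (r * 2 * K * s)) (at s)" for r s
    unfolding E_def by (rule derivative_eq_intros dD refl | simp)+ (simp add: power2_eq_square algebra_simps)
  have "E (-1) t \<le> E (-1) 0"
  proof (rule DERIV_nonpos_imp_nonincreasing[OF t])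
    fix s
    have "2 * (D s * D' s) + - 1 * 2 * K * (D s)\<^sup>2 \<le> 0" using DD[of s] by (simp add: abs_le_iff)
    then show "\<exists>y. (E (-1) has_real_derivative y) (at s) \<and> y \<le> 0"
      using dE[of "-1" s] by (intro exI conjI) (assumption, simp add: mult_nonpos_nonneg)
  qed
  then have "(D t)\<^sup>2 \<le> (D 0)\<^sup>2 * exp (2 * (K * t))"
    by (simp add: E_def exp_minus field_simps)
  also have "\<dots> = (\<bar>D 0\<bar> * exp (K * t))\<^sup>2" by (simp add: power_mult_distrib exp_double)
  finally show "\<bar>v t - w t\<bar> \<le> \<bar>v 0 - w 0\<bar> * exp (K * t)"
    unfolding D_def by (rule abs_le_square_iff[THEN iffD2, THEN order_trans]) simp
  have "E 1 0 \<le> E 1 t"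
  proof (rule DERIV_nonneg_imp_nondecreasing[OF t])
    fix s
    have "0 \<le> 2 * (D s * D' s) + 1 * 2 * K * (D s)\<^sup>2" using DD[of s] by (simp add: abs_le_iff)
    then show "\<exists>y. (E 1 has_real_derivative y) (at s) \<and> y \<ge> 0"
      using dE[of 1 s] by (intro exI conjI) (assumption, simp)
  qed
  then have "(\<bar>D 0\<bar> * exp (- K * t))\<^sup>2 \<le> (D t)\<^sup>2"
    by (simp add: E_def power_mult_distrib exp_minus field_simps flip: exp_double)
  then show "\<bar>v 0 - w 0\<bar> * exp (- K * t) \<le> \<bar>v t - w t\<bar>"
    unfolding D_def using abs_le_square_iff[of "\<bar>v 0 - w 0\<bar> * exp (- K * t)" "v t - w t"] by simp
qed

lemma positive_of_nonzero:
  fixes f :: "real \<Rightarrow> real"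
  assumes "\<And>t. isCont f t" "0 < f c" "c \<in> {l..r}" "\<And>t. t \<in> {l..r} \<Longrightarrow> f t \<noteq> 0" "t \<in> {l..r}"
  shows "0 < f t"
proof (rule ccontr)
  assume "\<not> 0 < f t"
  then have ft: "f t \<le> 0" by simp
  have "\<exists>s. s \<in> {l..r} \<and> f s = 0"
  proof (cases "c \<le> t")
    case True
    then obtain s where "c \<le> s" "s \<le> t" "f s = 0"
      using IVT2[of f t 0 c] ft assms(1,2) by auto
    then show ?thesis using assms(3,5) by (intro exI[of _ s]) auto
  next
    case False
    then obtain s where "t \<le> s" "s \<le> c" "f s = 0"
      using IVT[of f t 0 c] ft assms(1,2) by auto
    then show ?thesis using assms(3,5) by (intro exI[of _ s]) auto
  qed
  then show False using assms(4) by blast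
qed

text \<open>\<open>\<Phi> s\<close>, for \<open>s\<close> equal to 1 or -1, belongs to the linear
  equation that holds where \<open>s * u\<close> is nonnegative. Periodicity of \<open>A\<close> and
  \<open>\<Phi> s\<close> is derived from the center.\<close>

locale pl_center =
  fixes a b A :: "real \<Rightarrow> real" and u \<Phi> :: "real \<Rightarrow> real \<Rightarrow> real" and K :: real
  assumes sol: "pl_solution a b (\<lambda>t. u t x)" and init: "u 0 x = x"
    and bound: "\<bar>a t\<bar> \<le> K"
    and deriv_A: "(A has_real_derivative a t) (at t)"
    and deriv_\<Phi>: "(\<Phi> s has_real_derivative b t * exp (- s * A t)) (at t)"
    and center: "u (2 * pi) x = x"
begin

lemma deriv_u: "((\<lambda>t. u t x) has_real_derivative a t * \<bar>u t x\<bar> + b t) (at t)"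
  using sol unfolding pl_solution_def by blast

lemma cont_u: "isCont (\<lambda>t. u t x) t"
  using deriv_u by (rule DERIV_isCont)

lemma upper_gap: "0 \<le> t \<Longrightarrow> \<bar>u t x - u t y\<bar> \<le> \<bar>x - y\<bar> * exp (K * t)"
  and lower_gap: "0 \<le> t \<Longrightarrow> \<bar>x - y\<bar> * exp (- K * t) \<le> \<bar>u t x - u t y\<bar>"
  using pl_solution_gap[OF sol sol bound] by (simp_all add: init)

lemma cont_initial: "0 \<le> t \<Longrightarrow> isCont (u t) x"
proof -
  assume t: "0 \<le> t"
  have "((\<lambda>y. \<bar>y - x\<bar> * exp (K * t)) \<longlongrightarrow> \<bar>x - x\<bar> * exp (K * t)) (at x)"
    by (intro tendsto_intros)
  then have lim: "((\<lambda>y. \<bar>y - x\<bar> * exp (K * t)) \<longlongrightarrow> 0) (at x)" by simp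
  have "((\<lambda>y. u t y - u t x) \<longlongrightarrow> 0) (at x)"
    by (rule Lim_null_comparison[OF always_eventually lim])
      (simp only: real_norm_def upper_gap[OF t] simp_thms)
  then show ?thesis unfolding isCont_def by (simp add: LIM_zero_iff)
qed

text \<open>Variation of constants: where \<open>s * u\<close> is nonnegative the equation reads
  \<open>u' = s a u + b\<close>.\<close>

lemma one_signed:
  assumes "l \<le> r" "\<And>t. t \<in> {l<..<r} \<Longrightarrow> 0 \<le> s * u t x" "\<bar>s\<bar> = 1"
  shows "u r x * exp (- s * A r) - \<Phi> s r = u l x * exp (- s * A l) - \<Phi> s l"
proof (cases "l = r")
  case False
  let ?f = "\<lambda>t. u t x * exp (- s * A t) - \<Phi> s t"
  have d: "(?f has_real_derivative a t * (\<bar>u t x\<bar> - s * u t x) * exp (- s * A t)) (at t)" for t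
    by (rule derivative_eq_intros deriv_u deriv_A deriv_\<Phi> refl | simp)+ (simp add: algebra_simps)
  show ?thesis
  proof (rule DERIV_isconst_end[of l r ?f])
    show "l < r" using False assms(1) by simp
    show "continuous_on {l..r} ?f"
      by (rule DERIV_continuous_on[OF has_field_derivative_at_within[OF d]])
    fix t assume "l < t" "t < r"
    then have "0 \<le> s * u t x" using assms(2)[of t] by simp
    then have "\<bar>u t x\<bar> = s * u t x" using assms(3) by (metis abs_mult abs_of_nonneg mult_1)
    then show "(?f has_real_derivative 0) (at t)" using d[of t] by simp
  qed
qed simp

text \<open>The solution starting at 0 is bounded by \<open>B\<close> over the period, and
  \<open>R\<close> is chosen so that \<open>lower_gap\<close> keeps the other one at distance at
  least \<open>B + 1\<close> from it.\<close>

lemma large_positive: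
  assumes s: "\<bar>s\<bar> = 1"
  shows "\<exists>R. \<forall>y\<ge>R. \<forall>t\<in>{0..2*pi}. 0 < s * u t (s * y)"
proof -
  have "compact ((\<lambda>t. u t 0) ` {0..2*pi})"
    by (intro compact_continuous_image compact_Icc continuous_at_imp_continuous_on ballI cont_u)
  then have "bounded ((\<lambda>t. u t 0) ` {0..2*pi})" by (rule compact_imp_bounded)
  then obtain B where B: "\<And>t. t \<in> {0..2*pi} \<Longrightarrow> \<bar>u t 0\<bar> \<le> B"
    unfolding bounded_iff by (auto simp del: atLeastAtMost_iff)
  have K0: "0 \<le> K" using bound[of 0] by linarith
  have B0: "0 \<le> B" using B[of 0] by simp
  define R where "R = (B + 1) * exp (K * (2 * pi))"
  have R0: "0 < R" using B0 by (simp add: R_def)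
  have "0 < s * u t (s * y)" if y: "R \<le> y" and t: "t \<in> {0..2*pi}" for y t
  proof (rule positive_of_nonzero[of "\<lambda>t. s * u t (s * y)" 0 0 "2*pi" t])
    show "isCont (\<lambda>t. s * u t (s * y)) t" for t by (intro continuous_intros cont_u)
    have "s * s = 1" using s by (metis abs_mult_self_eq mult_1)
    then have "s * u 0 (s * y) = y" unfolding init by (metis mult.assoc mult_1)
    then show "0 < s * u 0 (s * y)" using R0 y by simp
    fix t :: real assume t: "t \<in> {0..2*pi}"
    have "R * exp (- K * t) \<le> y * exp (- K * t)" using y by simp
    also have "y = \<bar>s * y - 0\<bar>" using s R0 y by (simp add: abs_mult)
    also have "\<bar>s * y - 0\<bar> * exp (- K * t) \<le> \<bar>u t (s * y) - u t 0\<bar>"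
      by (rule lower_gap) (use t in simp)
    finally have 1: "R * exp (- K * t) \<le> \<bar>u t (s * y) - u t 0\<bar>" .
    have "exp (K * t) \<le> exp (K * (2 * pi))" using K0 t by (simp add: mult_left_mono)
    then have "(B + 1) * exp (K * t) \<le> R" unfolding R_def using B0 by simp
    then have "B + 1 \<le> R * exp (- K * t)" by (simp add: exp_minus field_simps)
    with 1 B[OF t] have "u t (s * y) \<noteq> 0" by auto
    then show "s * u t (s * y) \<noteq> 0" using s by auto
  qed (use t in auto)
  then show ?thesis by blast
qed

text \<open>Over a whole period \<open>one_signed\<close> gives, for every large \<open>y\<close>,
  an identity affine in \<open>y\<close>; comparing \<open>R\<close> and \<open>R + 1\<close>
  separates \<open>A\<close> from \<open>\<Phi> s\<close>.\<close>

lemma periodic_A: "A (2 * pi) = A 0"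
  and periodic_\<Phi>: "\<bar>s\<bar> = 1 \<Longrightarrow> \<Phi> s (2 * pi) = \<Phi> s 0"
proof -
  have *: "exp (- s * A (2 * pi)) = exp (- s * A 0) \<and> \<Phi> s (2 * pi) = \<Phi> s 0" if s: "\<bar>s\<bar> = 1" for s
  proof -
    obtain R where R: "\<And>y t. R \<le> y \<Longrightarrow> t \<in> {0..2*pi} \<Longrightarrow> 0 < s * u t (s * y)"
      using large_positive[OF s] by blast
    have eq: "s * y * exp (- s * A (2 * pi)) - \<Phi> s (2 * pi) = s * y * exp (- s * A 0) - \<Phi> s 0"
      if "R \<le> y" for y
      using one_signed[of 0 "2 * pi" s "s * y"] R[OF that] s
      by (auto simp: center init less_imp_le)
    have "s * exp (- s * A (2 * pi)) = s * exp (- s * A 0)"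
    proof -
      have "s * (R + 1) * v = s * R * v + s * v" for v by (simp add: algebra_simps)
      moreover have "R \<le> R + 1" by simp
      ultimately show ?thesis using eq[OF order_refl] eq[of "R + 1"] by (smt (verit))
    qed
    then have e: "exp (- s * A (2 * pi)) = exp (- s * A 0)" using s by auto
    from eq[OF order_refl] have "\<Phi> s (2 * pi) = \<Phi> s 0" unfolding e by linarith
    with e show ?thesis by blast
  qed
  show "\<bar>s\<bar> = 1 \<Longrightarrow> \<Phi> s (2 * pi) = \<Phi> s 0" using * by blast
  show "A (2 * pi) = A 0" using *[of 1] by simp
qed

end

section \<open>The two zeros as functions of the initial value\<close>

locale pl_pairs = pl_center a b A u \<Phi> K
  for a b A :: "real \<Rightarrow> real" and u \<Phi> :: "real \<Rightarrow> real \<Rightarrow> real" and K :: real +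
  fixes x1 x2 :: real and \<tau>1 \<tau>2 :: "real \<Rightarrow> real"
  assumes zeros: "x \<in> {x1<..<x2} \<Longrightarrow> {t\<in>{0<..<2*pi}. u t x = 0} = {\<tau>1 x, \<tau>2 x}"
    and less: "x \<in> {x1<..<x2} \<Longrightarrow> \<tau>1 x < \<tau>2 x"
    and simple: "x \<in> {x1<..<x2} \<Longrightarrow> b (\<tau>1 x) \<noteq> 0" "x \<in> {x1<..<x2} \<Longrightarrow> b (\<tau>2 x) \<noteq> 0"
begin

lemma zero_at:
  assumes "x \<in> {x1<..<x2}"
  shows "u (\<tau>1 x) x = 0" "u (\<tau>2 x) x = 0" "0 < \<tau>1 x" "\<tau>1 x < 2 * pi" "0 < \<tau>2 x" "\<tau>2 x < 2 * pi"
proof -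
  have "\<tau>1 x \<in> {t\<in>{0<..<2*pi}. u t x = 0}" "\<tau>2 x \<in> {t\<in>{0<..<2*pi}. u t x = 0}"
    unfolding zeros[OF assms] by auto
  then show "u (\<tau>1 x) x = 0" "u (\<tau>2 x) x = 0" "0 < \<tau>1 x" "\<tau>1 x < 2 * pi" "0 < \<tau>2 x" "\<tau>2 x < 2 * pi"
    by auto
qed

lemma zero_cases:
  assumes "x \<in> {x1<..<x2}" "0 < t" "t < 2 * pi" "u t x = 0"
  shows "t = \<tau>1 x \<or> t = \<tau>2 x"
proof -
  have "t \<in> {t\<in>{0<..<2*pi}. u t x = 0}" using assms by simp
  then show ?thesis unfolding zeros[OF assms(1)] by simp
qed

lemma sign_left:
  assumes x: "x \<in> {x1<..<x2}" "0 < s * x" and t: "0 \<le> t" "t < \<tau>1 x"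
  shows "0 < s * u t x"
proof (rule positive_of_nonzero[of "\<lambda>t. s * u t x" 0 0 t])
  show "isCont (\<lambda>t. s * u t x) t" for t by (intro continuous_intros cont_u)
  show "0 < s * u 0 x" using x by (simp add: init)
  fix r assume r: "r \<in> {0..t}"
  have "u r x \<noteq> 0"
  proof (cases "r = 0")
    case True
    then show ?thesis using x(2) by (auto simp: init)
  next
    case False
    then show ?thesis
      using zero_cases[OF x(1), of r] zero_at[OF x(1)] less[OF x(1)] r t by auto
  qed
  then show "s * u r x \<noteq> 0" using x(2) by auto
qed (use t in auto)

lemma sign_right:
  assumes x: "x \<in> {x1<..<x2}" "0 < s * x" and t: "\<tau>2 x < t" "t \<le> 2 * pi"
  shows "0 < s * u t x"
proof (rule positive_of_nonzero[of "\<lambda>t. s * u t x" "2 * pi" t "2 * pi"])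
  show "isCont (\<lambda>t. s * u t x) t" for t by (intro continuous_intros cont_u)
  show "0 < s * u (2 * pi) x" using x by (simp add: center)
  fix r assume r: "r \<in> {t..2*pi}"
  have "u r x \<noteq> 0"
  proof (cases "r = 2 * pi")
    case True
    then show ?thesis using x(2) by (auto simp: center)
  next
    case False
    then show ?thesis
      using zero_cases[OF x(1), of r] zero_at[OF x(1)] less[OF x(1)] r t by auto
  qed
  then show "s * u r x \<noteq> 0" using x(2) by auto
qed (use t in auto)

text \<open>At the first zero the derivative is \<open>b (\<tau>1 x)\<close>, which is nonzero, so
  the sign changes there, and it persists until the second zero.\<close>

lemma sign_middle:
  assumes x: "x \<in> {x1<..<x2}" "0 < s * x" and t: "\<tau>1 x < t" "t < \<tau>2 x"
  shows "s * u t x < 0"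
proof -
  have d: "((\<lambda>t. s * u t x) has_real_derivative s * b (\<tau>1 x)) (at (\<tau>1 x))"
    using DERIV_cmult[OF deriv_u[of x "\<tau>1 x"], of s] by (simp add: zero_at[OF x(1)])
  have "\<not> 0 < s * b (\<tau>1 x)"
  proof
    assume "0 < s * b (\<tau>1 x)"
    from DERIV_pos_inc_left[OF d this] obtain e where e: "0 < e"
      "\<And>h. 0 < h \<Longrightarrow> h < e \<Longrightarrow> s * u (\<tau>1 x - h) x < s * u (\<tau>1 x) x" by blast
    define h where "h = min (e / 2) (\<tau>1 x / 2)"
    have "0 < h" "h < e" "h < \<tau>1 x" using e(1) zero_at[OF x(1)] by (auto simp: h_def)
    then show False using e(2)[of h] sign_left[OF x, of "\<tau>1 x - h"] by (simp add: zero_at[OF x(1)])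
  qed
  moreover have "s * b (\<tau>1 x) \<noteq> 0" using simple(1)[OF x(1)] x(2) by auto
  ultimately have "s * b (\<tau>1 x) < 0" by linarith
  from DERIV_neg_dec_right[OF d this] obtain e where e: "0 < e"
      "\<And>h. 0 < h \<Longrightarrow> h < e \<Longrightarrow> s * u (\<tau>1 x + h) x < s * u (\<tau>1 x) x" by blast
  define c where "c = \<tau>1 x + min (e / 2) (t - \<tau>1 x)"
  have c: "\<tau>1 x < c" "c \<le> t" using e(1) t by (auto simp: c_def)
  have "s * u c x < 0"
    using e(1) e(2)[of "min (e / 2) (t - \<tau>1 x)"] t by (simp add: zero_at[OF x(1)] c_def)
  have "0 < - s * u t x"
  proof (rule positive_of_nonzero[of "\<lambda>t. - s * u t x" c c t])
    show "isCont (\<lambda>t. - s * u t x) t" for t by (intro continuous_intros cont_u)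
    show "0 < - s * u c x" using \<open>s * u c x < 0\<close> by simp
    fix r assume r: "r \<in> {c..t}"
    then have "u r x \<noteq> 0"
      using zero_cases[OF x(1), of r] zero_at[OF x(1)] c t by auto
    then show "- s * u r x \<noteq> 0" using x(2) by auto
  qed (use c in auto)
  then show ?thesis by simp
qed

text \<open>\<open>one_signed\<close> on the three intervals cut out by the zeros: sign
  \<open>s\<close> on the outer two, \<open>- s\<close> on the middle one. The last interval uses
  the center and the periodicity of \<open>A\<close> and \<open>\<Phi> s\<close>.\<close>

lemma \<Phi>_at_zero:
  assumes x: "x \<in> {x1<..<x2}" "0 < s * x" and s: "\<bar>s\<bar> = 1"
  shows "\<Phi> s (\<tau>1 x) = \<Phi> s 0 - x * exp (- s * A 0)" (is ?first)
    and "\<Phi> s (\<tau>2 x) = \<Phi> s 0 - x * exp (- s * A 0)" (is ?second)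
    and "\<Phi> (- s) (\<tau>1 x) = \<Phi> (- s) (\<tau>2 x)" (is ?middle)
proof -
  show ?first
    using one_signed[of 0 "\<tau>1 x" s x] sign_left[OF x] zero_at[OF x(1)] s
    by (force simp: init less_imp_le)
  show ?second
    using one_signed[of "\<tau>2 x" "2 * pi" s x] sign_right[OF x] zero_at[OF x(1)] s
    by (force simp: center less_imp_le periodic_A periodic_\<Phi>)
  have "0 \<le> - s * u t x" if "t \<in> {\<tau>1 x<..<\<tau>2 x}" for t
    using sign_middle[OF x, of t] that by auto
  then show ?middle
    using one_signed[of "\<tau>1 x" "\<tau>2 x" "- s" x] zero_at[OF x(1)] less[OF x(1)] s by simp
qed

text \<open>The signs of \<open>u\<close> at distance \<eta> on both sides of each zero persist for
  nearby \<open>y\<close>, which forces a zero in each of two disjoint intervals; there are no zeros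
  other than these two.\<close>

lemma zeros_near:
  assumes x: "x \<in> {x1<..<x2}" "0 < s * x" and \<epsilon>: "0 < \<epsilon>"
  shows "\<forall>\<^sub>F y in at x. \<bar>\<tau>1 y - \<tau>1 x\<bar> < \<epsilon> \<and> \<bar>\<tau>2 y - \<tau>2 x\<bar> < \<epsilon>"
proof -
  note z = zero_at[OF x(1)] less[OF x(1)]
  define \<eta> where "\<eta> = min \<epsilon> (min (\<tau>1 x) (min ((\<tau>2 x - \<tau>1 x) / 2) (2 * pi - \<tau>2 x))) / 2"
  have \<eta>: "0 < \<eta>" "\<eta> < \<epsilon>" "\<eta> < \<tau>1 x" "2 * \<eta> < \<tau>2 x - \<tau>1 x" "\<eta> < 2 * pi - \<tau>2 x"
    using z \<epsilon> unfolding \<eta>_def by (auto simp: min_def)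
  have lim: "((\<lambda>y. s * u t y) \<longlongrightarrow> s * u t x) (at x)" if "0 \<le> t" for t
    using cont_initial[OF that, of x] unfolding isCont_def by (intro tendsto_intros)
  have "\<forall>\<^sub>F y in at x. y \<in> {x1<..<x2}"
    using x(1) by (intro eventually_at_in_open') auto
  moreover have "\<forall>\<^sub>F y in at x. 0 < s * u (\<tau>1 x - \<eta>) y"
    by (rule order_tendstoD(1)[OF lim]) (use \<eta> z sign_left[OF x] in auto)
  moreover have "\<forall>\<^sub>F y in at x. s * u (\<tau>1 x + \<eta>) y < 0"
    by (rule order_tendstoD(2)[OF lim]) (use \<eta> z sign_middle[OF x] in auto)
  moreover have "\<forall>\<^sub>F y in at x. s * u (\<tau>2 x - \<eta>) y < 0"
    by (rule order_tendstoD(2)[OF lim]) (use \<eta> z sign_middle[OF x] in auto)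
  moreover have "\<forall>\<^sub>F y in at x. 0 < s * u (\<tau>2 x + \<eta>) y"
    by (rule order_tendstoD(1)[OF lim]) (use \<eta> z sign_right[OF x] in auto)
  ultimately show ?thesis
  proof eventually_elim
    case (elim y)
    have cont: "isCont (\<lambda>t. s * u t y) t" for t by (intro continuous_intros cont_u)
    have s0: "s \<noteq> 0" using x(2) by auto
    obtain p where p: "\<tau>1 x - \<eta> \<le> p" "p \<le> \<tau>1 x + \<eta>" "s * u p y = 0"
      using IVT2[of "\<lambda>t. s * u t y" "\<tau>1 x + \<eta>" 0 "\<tau>1 x - \<eta>"] cont elim \<eta> by auto
    obtain r where r: "\<tau>2 x - \<eta> \<le> r" "r \<le> \<tau>2 x + \<eta>" "s * u r y = 0"
      using IVT[of "\<lambda>t. s * u t y" "\<tau>2 x - \<eta>" 0 "\<tau>2 x + \<eta>"] cont elim \<eta> by auto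
    have "p = \<tau>1 y \<or> p = \<tau>2 y" "r = \<tau>1 y \<or> r = \<tau>2 y"
      using zero_cases[OF elim(1), of p] zero_cases[OF elim(1), of r] p r \<eta> z s0 by auto
    moreover have "p < r" using p r \<eta> by linarith
    ultimately have "p = \<tau>1 y" "r = \<tau>2 y" using less[OF elim(1)] by auto
    then show ?case using p r \<eta> by auto
  qed
qed

lemma cont_zeros:
  assumes x: "x \<in> {x1<..<x2}" "0 < s * x"
  shows "isCont \<tau>1 x" "isCont \<tau>2 x"
  unfolding isCont_def tendsto_iff dist_real_def
  by (auto intro: eventually_mono[OF zeros_near[OF x]])

text \<open>By \<open>\<Phi>_at_zero\<close> both zeros are inverse branches of one function
  \<open>f\<close>, with derivative \<open>D\<close>, nonzero at simple zeros. The third claim gives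
  a neighbourhood on which identities in \<open>x\<close> can be differentiated.\<close>

lemma deriv_zero:
  fixes s x :: real
  defines "D t \<equiv> - exp (s * A 0) * (b t * exp (- s * A t))"
  assumes x: "x \<in> {x1<..<x2}" "0 < s * x" and s: "\<bar>s\<bar> = 1"
  shows "(\<tau>1 has_real_derivative inverse (D (\<tau>1 x))) (at x)"
    and "(\<tau>2 has_real_derivative inverse (D (\<tau>2 x))) (at x)"
    and "\<exists>e>0. \<forall>y. \<bar>x - y\<bar> < e \<longrightarrow> y \<in> {x1<..<x2} \<and> 0 < s * y"
proof -
  define U where "U = {x1<..<x2} \<inter> {y. 0 < s * y}"
  have "open U" unfolding U_def by (intro open_Int open_greaterThanLessThan open_Collect_less continuous_intros)
  moreover have "x \<in> U" using x by (simp add: U_def)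
  ultimately obtain e where e: "e > 0" "\<And>y. dist y x < e \<Longrightarrow> y \<in> U"
    unfolding open_dist by blast
  then have U: "y \<in> U" if "\<bar>x - y\<bar> < e" for y using that by (simp add: dist_real_def abs_minus_commute)
  then show "\<exists>e>0. \<forall>y. \<bar>x - y\<bar> < e \<longrightarrow> y \<in> {x1<..<x2} \<and> 0 < s * y"
    using e(1) unfolding U_def by blast
  define f where "f t = (\<Phi> s 0 - \<Phi> s t) * exp (s * A 0)" for t
  have df: "(f has_real_derivative D t) (at t)" for t
    unfolding f_def D_def by (rule derivative_eq_intros deriv_\<Phi> refl | simp)+
  have inv: "f (\<tau>1 y) = y" "f (\<tau>2 y) = y" if "y \<in> U" for y
    using \<Phi>_at_zero[of y s] that s unfolding f_def U_def by (auto simp: exp_minus)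
  have D0: "D (\<tau>1 x) \<noteq> 0" "D (\<tau>2 x) \<noteq> 0"
    using simple[OF x(1)] by (simp_all add: D_def)
  show "(\<tau>1 has_real_derivative inverse (D (\<tau>1 x))) (at x)"
    by (rule DERIV_inverse_function[where f = f and D = "D (\<tau>1 x)" and a = "x - e" and b = "x + e"])
      (use e(1) df D0 inv U cont_zeros[OF x] in \<open>auto simp: abs_less_iff\<close>)
  show "(\<tau>2 has_real_derivative inverse (D (\<tau>2 x))) (at x)"
    by (rule DERIV_inverse_function[where f = f and D = "D (\<tau>2 x)" and a = "x - e" and b = "x + e"])
      (use e(1) df D0 inv U cont_zeros[OF x] in \<open>auto simp: abs_less_iff\<close>)
qed

text \<open>Differentiating \<open>\<Phi> (\<plusminus> s) (\<tau>1 x) = \<Phi> (\<plusminus> s) (\<tau>2 x)\<close> and dividing the two relations.\<close>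

lemma A_at_zeros:
  assumes x: "x \<in> {x1<..<x2}" "0 < s * x" and s: "\<bar>s\<bar> = 1"
  shows "A (\<tau>1 x) = A (\<tau>2 x)"
proof -
  note d = deriv_zero[OF x s]
  obtain e where e: "e > 0" "\<And>y. \<bar>x - y\<bar> < e \<Longrightarrow> y \<in> {x1<..<x2} \<and> 0 < s * y" using d(3) by blast
  let ?G = "\<lambda>y. \<Phi> (- s) (\<tau>1 y) - \<Phi> (- s) (\<tau>2 y)"
  let ?I = "\<lambda>t. inverse (- exp (s * A 0) * (b t * exp (- s * A t)))"
  have "(?G has_real_derivative b (\<tau>1 x) * exp (- (- s) * A (\<tau>1 x)) * ?I (\<tau>1 x)
      - b (\<tau>2 x) * exp (- (- s) * A (\<tau>2 x)) * ?I (\<tau>2 x)) (at x)"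
    by (intro DERIV_diff DERIV_chain2[OF deriv_\<Phi>] d)
  moreover have "\<forall>y. \<bar>x - y\<bar> < e \<longrightarrow> ?G x = ?G y"
    using \<Phi>_at_zero(3)[OF x s] \<Phi>_at_zero(3)[OF _ _ s] e(2) by simp
  ultimately have "b (\<tau>1 x) * exp (- (- s) * A (\<tau>1 x)) * ?I (\<tau>1 x)
      - b (\<tau>2 x) * exp (- (- s) * A (\<tau>2 x)) * ?I (\<tau>2 x) = 0"
    by (rule DERIV_local_const[OF _ e(1)])
  moreover have I: "b t * exp (- (- s) * A t) * ?I t = - exp (2 * (s * A t)) / exp (s * A 0)" if "b t \<noteq> 0" for t
    using that unfolding exp_double by (simp add: exp_minus field_simps power2_eq_square)
  ultimately have "exp (2 * (s * A (\<tau>1 x))) = exp (2 * (s * A (\<tau>2 x)))"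
    unfolding I[OF simple(1)[OF x(1)]] I[OF simple(2)[OF x(1)]] by auto
  then show ?thesis using x(2) by auto
qed

text \<open>Differentiate \<open>A (\<tau>1 x) = A (\<tau>2 x)\<close>; the same equality cancels
  the exponentials.\<close>

lemma cross_at_zeros:
  assumes x: "x \<in> {x1<..<x2}" "0 < s * x" and s: "\<bar>s\<bar> = 1"
  shows "a (\<tau>1 x) * b (\<tau>2 x) = a (\<tau>2 x) * b (\<tau>1 x)"
proof -
  note d = deriv_zero[OF x s]
  obtain e where e: "e > 0" "\<And>y. \<bar>x - y\<bar> < e \<Longrightarrow> y \<in> {x1<..<x2} \<and> 0 < s * y" using d(3) by blast
  let ?G = "\<lambda>y. A (\<tau>1 y) - A (\<tau>2 y)"
  let ?I = "\<lambda>t. inverse (- exp (s * A 0) * (b t * exp (- s * A t)))"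
  have "(?G has_real_derivative a (\<tau>1 x) * ?I (\<tau>1 x) - a (\<tau>2 x) * ?I (\<tau>2 x)) (at x)"
    by (intro DERIV_diff DERIV_chain2[OF deriv_A] d)
  moreover have "\<forall>y. \<bar>x - y\<bar> < e \<longrightarrow> ?G x = ?G y"
    using A_at_zeros[OF x s] A_at_zeros[OF _ _ s] e(2) by simp
  ultimately have "a (\<tau>1 x) * ?I (\<tau>1 x) - a (\<tau>2 x) * ?I (\<tau>2 x) = 0"
    by (rule DERIV_local_const[OF _ e(1)])
  then show ?thesis
    using simple[OF x(1)] unfolding A_at_zeros[OF x s] by (simp add: field_simps)
qed

lemma pairs:
  assumes "x \<in> {x1<..<x2}" "x \<noteq> 0"
  shows "A (\<tau>1 x) = A (\<tau>2 x)" "a (\<tau>1 x) * b (\<tau>2 x) = a (\<tau>2 x) * b (\<tau>1 x)"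
proof -
  have "0 < sgn x * x" "\<bar>sgn x\<bar> = 1" using assms(2) by (auto simp: sgn_if)
  then show "A (\<tau>1 x) = A (\<tau>2 x)" "a (\<tau>1 x) * b (\<tau>2 x) = a (\<tau>2 x) * b (\<tau>1 x)"
    using A_at_zeros[OF assms(1)] cross_at_zeros[OF assms(1)] by blast+
qed

text \<open>By \<open>lower_gap\<close> different solutions never meet. Injectivity later turns
  finitely many polynomial roots into finitely many exceptional \<open>x\<close>.\<close>

lemma inj_zeros: "inj_on \<tau>1 {x1<..<x2}" "inj_on \<tau>2 {x1<..<x2}"
proof -
  have "x = y" if "0 \<le> t" "u t x = 0" "u t y = 0" for x y t
    using lower_gap[OF that(1), of x y] that(2,3) by (simp add: mult_le_0_iff not_le[symmetric])
  then show "inj_on \<tau>1 {x1<..<x2}" "inj_on \<tau>2 {x1<..<x2}"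
    by (auto intro!: inj_onI) (metis greaterThanLessThan_iff less_imp_le zero_at)+
qed

end

section \<open>The equation in the variable \<open>h\<close>\<close>

text \<open>To the right of 0, \<open>c / K * exp (K * r) - G r\<close> is nondecreasing; the other
  bounds come from changing the signs of \<open>G\<close> and of \<open>r\<close>.\<close>

lemma antiderivative_exp_bound:
  fixes G g :: "real \<Rightarrow> real"
  assumes G: "\<And>r. (G has_real_derivative g r) (at r)" "G 0 = 0"
    and g: "\<And>r. \<bar>g r\<bar> \<le> c * exp (K * \<bar>r\<bar>)" and K: "0 < K"
  shows "\<bar>G s\<bar> \<le> c / K * exp (K * \<bar>s\<bar>)"
proof -
  have c0: "0 \<le> c" using g[of 0] by simp
  have right: "G s \<le> c / K * exp (K * s)" if s: "0 \<le> s"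
    and G: "\<And>r. (G has_real_derivative g r) (at r)" "G 0 = 0"
    and g: "\<And>r. \<bar>g r\<bar> \<le> c * exp (K * \<bar>r\<bar>)" for G g :: "real \<Rightarrow> real" and s
  proof -
    have "c / K * exp (K * 0) - G 0 \<le> c / K * exp (K * s) - G s"
    proof (rule DERIV_nonneg_imp_nondecreasing[OF s])
      fix r :: real assume "0 \<le> r"
      have "((\<lambda>r. c / K * exp (K * r) - G r) has_real_derivative c * exp (K * r) - g r) (at r)"
        by (rule derivative_eq_intros G(1) refl | simp)+ (use K in simp)
      moreover have "0 \<le> c * exp (K * r) - g r" using g[of r] \<open>0 \<le> r\<close> by (simp add: abs_le_iff)
      ultimately show "\<exists>y. ((\<lambda>r. c / K * exp (K * r) - G r) has_real_derivative y) (at r) \<and> 0 \<le> y"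
        by blast
    qed
    moreover have "0 \<le> c / K" using c0 K by simp
    ultimately show ?thesis using G(2) by simp
  qed
  have neg: "((\<lambda>r. - G r) has_real_derivative - g r) (at r)" for r
    using G(1) by (rule DERIV_minus)
  have refl: "((\<lambda>r. G (- r)) has_real_derivative - g (- r)) (at r)" for r
    using DERIV_chain2[where f = G and g = uminus, OF G(1) DERIV_minus[OF DERIV_ident]] by simp
  have neg_refl: "((\<lambda>r. - G (- r)) has_real_derivative g (- r)) (at r)" for r
    using DERIV_minus[OF refl] by simp
  have g': "\<bar>- g r\<bar> \<le> c * exp (K * \<bar>r\<bar>)" "\<bar>g (- r)\<bar> \<le> c * exp (K * \<bar>r\<bar>)"
    "\<bar>- g (- r)\<bar> \<le> c * exp (K * \<bar>r\<bar>)" for r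
    using g[of r] g[of "- r"] by simp_all
  show ?thesis
  proof (cases "0 \<le> s")
    case True
    then show ?thesis
      using right[OF True G g] right[OF True neg _ g'(1)] G(2) by (simp add: abs_le_iff)
  next
    case False
    then have s: "0 \<le> - s" by simp
    show ?thesis
      using right[OF s refl _ g'(3)] right[OF s neg_refl _ g'(2)] G(2) False by (simp add: abs_le_iff)
  qed
qed

text \<open>Picard iteration for \<open>exp (- K \<bar>s\<bar>) X s\<close>: the weight makes the integral operator a
  contraction on all bounded continuous functions of the real line.\<close>

lemma pl_solution_exists_at_0:
  assumes p: "continuous_on UNIV p" "\<And>s. \<bar>p s\<bar> \<le> C" and q: "continuous_on UNIV q" "\<And>s. \<bar>q s\<bar> \<le> C"
    and C: "0 < C"
  shows "\<exists>X. X 0 = x0 \<and> pl_solution p q X"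
proof -
  \<comment> \<open>The contraction constant will be \<open>C / K\<close>, here one half.\<close>
  define K where "K = 2 * C"
  have K: "0 < K" using C by (simp add: K_def)
  define E where "E s = exp (K * \<bar>s\<bar>)" for s :: real
  have E: "1 \<le> E s" "0 < E s" "continuous_on UNIV E" for s
    using K unfolding E_def by (auto intro!: continuous_intros)
  \<comment> \<open>\<open>Y\<close> is the weighted solution, so \<open>E s * Y s\<close> plays the
    role of \<open>X s\<close> in the right-hand side.\<close>
  define g where "g Y s = p s * \<bar>E s * apply_bcontfun Y s\<bar> + q s" for Y s
  have cont_g: "continuous_on UNIV (g Y)" for Y
    unfolding g_def by (intro continuous_intros p(1) q(1) E(3) continuous_on_apply_bcontfun)
  have "\<forall>Y. \<exists>G. G 0 = 0 \<and> (\<forall>s. (G has_real_derivative g Y s) (at s))"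
  proof
    fix Y
    have "isCont (g Y) t" for t using cont_g[of Y] by (simp add: continuous_on_eq_continuous_at)
    from antiderivative_exists[OF this] obtain G where G: "\<And>s. (G has_real_derivative g Y s) (at s)" by blast
    have "((\<lambda>s. G s - G 0) has_real_derivative g Y s) (at s)" for s
      using DERIV_diff[OF G DERIV_const] by simp
    then show "\<exists>G. G 0 = 0 \<and> (\<forall>s. (G has_real_derivative g Y s) (at s))"
      by (intro exI[of _ "\<lambda>s. G s - G 0"]) simp
  qed
  from choice[OF this] obtain \<Gamma> where
    \<Gamma>0: "\<And>Y. \<Gamma> Y 0 = 0" and \<Gamma>: "\<And>Y s. (\<Gamma> Y has_real_derivative g Y s) (at s)" by blast
  define f where "f Y s = (x0 + \<Gamma> Y s) / E s" for Y s
  have gb: "\<bar>g Y s\<bar> \<le> (C * norm Y + C) * E s" for Y s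
  proof -
    have "\<bar>p s * \<bar>E s * apply_bcontfun Y s\<bar>\<bar> \<le> C * (E s * norm Y)"
      using p(2)[of s] norm_bounded[of Y s] E(2)[of s] C unfolding abs_mult abs_abs
      by (intro mult_mono) auto
    moreover have "C * 1 \<le> C * E s" by (rule mult_left_mono[OF E(1)]) (use C in simp)
    then have "\<bar>q s\<bar> \<le> C * E s" using q(2)[of s] by linarith
    ultimately show ?thesis unfolding g_def by (simp add: algebra_simps)
  qed
  have f_in: "f Y \<in> bcontfun" for Y
  proof (rule bcontfun_normI)
    have "continuous_on UNIV (\<Gamma> Y)" using \<Gamma> by (meson DERIV_continuous_on has_field_derivative_at_within)
    then show "continuous_on UNIV (f Y)"
      unfolding f_def using E(2) by (intro continuous_intros E(3)) (auto simp: less_imp_neq[symmetric])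
    fix s
    have "\<bar>\<Gamma> Y s\<bar> \<le> (C * norm Y + C) / K * E s"
      unfolding E_def by (rule antiderivative_exp_bound[OF \<Gamma> \<Gamma>0 _ K]) (use gb in \<open>simp add: E_def\<close>)
    then have "\<bar>x0 + \<Gamma> Y s\<bar> \<le> (\<bar>x0\<bar> + (C * norm Y + C) / K) * E s"
      using E(1)[of s] mult_left_mono[of 1 "E s" "\<bar>x0\<bar>"] by (simp add: distrib_right)
    then show "norm (f Y s) \<le> \<bar>x0\<bar> + (C * norm Y + C) / K"
      unfolding f_def using E(2)[of s] by (simp add: pos_divide_le_eq)
  qed
  define T where "T Y = Bcontfun (f Y)" for Y
  have T: "apply_bcontfun (T Y) = f Y" for Y
    unfolding T_def using f_in by (rule Bcontfun_inverse)
  have "dist (T Y) (T Z) \<le> 1 / 2 * dist Y Z" for Y Z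
  proof (rule dist_bound)
    fix s
    have "((\<lambda>s. \<Gamma> Y s - \<Gamma> Z s) has_real_derivative g Y s - g Z s) (at s)" for s
      by (intro DERIV_diff \<Gamma>)
    moreover have "\<bar>g Y s - g Z s\<bar> \<le> C * dist Y Z * exp (K * \<bar>s\<bar>)" for s
    proof -
      have "\<bar>\<bar>E s * apply_bcontfun Y s\<bar> - \<bar>E s * apply_bcontfun Z s\<bar>\<bar> \<le> \<bar>E s * apply_bcontfun Y s - E s * apply_bcontfun Z s\<bar>"
        by (rule abs_triangle_ineq3)
      also have "\<dots> = E s * dist (apply_bcontfun Y s) (apply_bcontfun Z s)"
        using E(2)[of s] by (simp add: dist_real_def abs_mult flip: right_diff_distrib)
      also have "\<dots> \<le> E s * dist Y Z" using E(2)[of s] dist_bounded[of Y s Z] by simp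
      finally have "\<bar>p s\<bar> * \<bar>\<bar>E s * apply_bcontfun Y s\<bar> - \<bar>E s * apply_bcontfun Z s\<bar>\<bar> \<le> C * (E s * dist Y Z)"
        using p(2)[of s] C by (intro mult_mono) auto
      then show ?thesis
        unfolding g_def E_def by (simp add: abs_mult mult_ac flip: right_diff_distrib)
    qed
    ultimately have "\<bar>\<Gamma> Y s - \<Gamma> Z s\<bar> \<le> C * dist Y Z / K * exp (K * \<bar>s\<bar>)"
      by (intro antiderivative_exp_bound[of "\<lambda>s. \<Gamma> Y s - \<Gamma> Z s" "\<lambda>s. g Y s - g Z s"])
        (simp_all add: K \<Gamma>0)
    then have "\<bar>\<Gamma> Y s - \<Gamma> Z s\<bar> \<le> 1 / 2 * dist Y Z * E s"
      using C unfolding K_def E_def by simp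
    moreover have "dist (f Y s) (f Z s) = \<bar>\<Gamma> Y s - \<Gamma> Z s\<bar> / E s"
      unfolding f_def dist_real_def using E(2)[of s] by (simp add: abs_divide flip: diff_divide_distrib)
    ultimately show "dist (apply_bcontfun (T Y) s) (apply_bcontfun (T Z) s) \<le> 1 / 2 * dist Y Z"
      unfolding T using E(2)[of s] by (simp add: pos_divide_le_eq)
  qed
  then obtain Y where Y: "T Y = Y" using banach_fix_type[of "1 / 2" T] by auto
  define X where "X s = x0 + \<Gamma> Y s" for s
  have "E s * apply_bcontfun Y s = X s" for s
    using T[of Y] E(2)[of s] unfolding Y by (simp add: f_def X_def)
  then have "g Y s = p s * \<bar>X s\<bar> + q s" for s by (simp add: g_def)
  moreover have "(X has_real_derivative g Y s) (at s)" for s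
    unfolding X_def using DERIV_add[OF DERIV_const \<Gamma>] by simp
  ultimately have "pl_solution p q X" unfolding pl_solution_def by simp
  then show ?thesis using \<Gamma>0 by (intro exI[of _ X]) (simp add: X_def)
qed

lemma pl_solution_exists:
  assumes "continuous_on UNIV p" "\<And>s. \<bar>p s\<bar> \<le> C" "continuous_on UNIV q" "\<And>s. \<bar>q s\<bar> \<le> C" "0 < C"
  shows "\<exists>X. X c = x0 \<and> pl_solution p q X"
proof -
  have shift: "continuous_on UNIV (\<lambda>s. f (s + c))" if "continuous_on UNIV f" for f :: "real \<Rightarrow> real"
    by (rule continuous_on_compose2[OF that]) (auto intro: continuous_intros)
  from pl_solution_exists_at_0[OF shift[OF assms(1)] assms(2) shift[OF assms(3)] assms(4,5)]
  obtain X where X: "X 0 = x0" "pl_solution (\<lambda>s. p (s + c)) (\<lambda>s. q (s + c)) X" by blast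
  have "((\<lambda>s. X (s - c)) has_real_derivative p s * \<bar>X (s - c)\<bar> + q s) (at s)" for s
  proof -
    have "(X has_real_derivative p s * \<bar>X (s - c)\<bar> + q s) (at (s - c))"
      using X(2)[unfolded pl_solution_def, rule_format, of "s - c"] by simp
    moreover have "((\<lambda>s. s - c) has_real_derivative 1) (at s)"
      by (auto intro!: derivative_eq_intros)
    ultimately show ?thesis
      using DERIV_chain2[where f = X and g = "\<lambda>s. s - c" and x = s and Db = 1] by simp
  qed
  then have "pl_solution p q (\<lambda>s. X (s - c))" unfolding pl_solution_def by blast
  then show ?thesis using X(1) by (intro exI[of _ "\<lambda>s. X (s - c)"]) simp
qed

lemma composition_imp_center:
  assumes a: "trig_degree_le n a" and h: "trig_degree_le m h"
    and aP: "\<And>t. a t = poly P (h t) * deriv h t" and bQ: "\<And>t. b t = poly Q (h t) * deriv h t"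
    and v: "pl_solution a b v"
  shows "v (2 * pi) = v 0"
proof -
  obtain h' where h': "\<And>t. (h has_real_derivative h' t) (at t)"
    using trig_degree_le_deriv[OF h] by blast
  then have dh: "deriv h t = h' t" for t by (rule DERIV_imp_deriv)
  obtain B where B: "\<And>t. \<bar>h t\<bar> \<le> B" using trig_degree_le_bounded[OF h] by blast
  have B0: "0 \<le> B" using B[of 0] by linarith
  \<comment> \<open>Clamping to an interval containing the range of \<open>h\<close> makes the
    coefficients bounded, hence \<open>X\<close> global, and changes nothing along
    \<open>h\<close>.\<close>
  define k where "k s = max (- B) (min B s)" for s :: real
  have k_h: "k (h t) = h t" for t using B[of t] by (auto simp: k_def abs_le_iff)
  have k_in: "k s \<in> {- B..B}" for s using B0 by (auto simp: k_def)
  have cont_k: "continuous_on UNIV (\<lambda>s. poly R (k s))" for R :: "real poly"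
    unfolding k_def by (intro continuous_intros)
  have "\<exists>C. \<forall>s. \<bar>poly R (k s)\<bar> \<le> C" for R :: "real poly"
  proof -
    have "compact (poly R ` {- B..B})"
      by (intro compact_continuous_image compact_Icc continuous_intros)
    then have "bounded (poly R ` {- B..B})" by (rule compact_imp_bounded)
    then obtain C where "\<And>s. s \<in> {- B..B} \<Longrightarrow> \<bar>poly R s\<bar> \<le> C"
      unfolding bounded_iff by (auto simp del: atLeastAtMost_iff)
    then show ?thesis using k_in by blast
  qed
  from this[of P] this[of Q] obtain C1 C2 where
    C1: "\<And>s. \<bar>poly P (k s)\<bar> \<le> C1" and C2: "\<And>s. \<bar>poly Q (k s)\<bar> \<le> C2" by blast
  define C where "C = max 1 (max C1 C2)"
  have C: "\<bar>poly P (k s)\<bar> \<le> C" "\<bar>poly Q (k s)\<bar> \<le> C" "0 < C" for s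
    using C1[of s] C2[of s] by (auto simp: C_def)
  from pl_solution_exists[OF cont_k[of P] C(1) cont_k[of Q] C(2,3), of "h 0" "v 0"]
  obtain X where X: "X (h 0) = v 0" "pl_solution (\<lambda>s. poly P (k s)) (\<lambda>s. poly Q (k s)) X"
    by blast
  define w where "w t = X (h t)" for t
  have "(w has_real_derivative a t * \<bar>w t\<bar> + b t) (at t)" for t
  proof -
    have "(X has_real_derivative poly P (h t) * \<bar>X (h t)\<bar> + poly Q (h t)) (at (h t))"
      using X(2) k_h[of t] unfolding pl_solution_def by metis
    from DERIV_chain2[where f = X and g = h, OF this h'[of t]] show ?thesis
      unfolding w_def by (rule DERIV_cong) (simp add: aP bQ dh algebra_simps)
  qed
  then have w: "pl_solution a b w" unfolding pl_solution_def by blast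
  obtain K where K: "\<And>t. \<bar>a t\<bar> \<le> K" using trig_degree_le_bounded[OF a] by blast
  have "\<bar>v (2 * pi) - w (2 * pi)\<bar> \<le> \<bar>v 0 - w 0\<bar> * exp (K * (2 * pi))"
    by (rule pl_solution_gap(1)[OF v w K]) simp
  moreover have "w 0 = v 0" by (simp add: w_def X)
  moreover have "w (2 * pi) = v 0"
    using trig_degree_le_periodic[OF h, of 0] by (simp add: w_def X)
  ultimately show ?thesis by simp
qed

section \<open>The characterisation\<close>

text \<open>The solution itself is an antiderivative of \<open>b\<close>; its periodicity forces the
  mean value \<open>k\<close> to vanish.\<close>

lemma zero_coefficient_center:
  assumes b: "trig_degree_le n b" and v: "pl_solution (\<lambda>_. 0) b v" and per: "v (2 * pi) = v 0"
  shows "\<exists>h. trig_degree_le n h \<and> (\<forall>t. (h has_real_derivative b t) (at t))"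
proof -
  obtain h k where h: "trig_degree_le n h" "\<And>t. (h has_real_derivative b t - k) (at t)"
    using trig_degree_le_antideriv[OF b] by blast
  have "((\<lambda>t. v t - h t - k * t) has_real_derivative 0) (at t)" for t
    using v h(2)[of t] unfolding pl_solution_def by (auto intro!: derivative_eq_intros)
  then have "v (2 * pi) - h (2 * pi) - k * (2 * pi) = v 0 - h 0 - k * 0"
    using DERIV_isconst_all by blast
  then have "k = 0" using per trig_degree_le_periodic[OF h(1), of 0] by simp
  then show ?thesis using h by auto
qed

lemma cis_eq_imp:
  assumes "cis x = cis y" "\<bar>x - y\<bar> < 2 * pi"
  shows "x = y"
proof -
  have "sin x = sin y \<and> cos x = cos y" using assms(1) by (simp add: complex_eq_iff)
  then obtain n :: int where n: "x = y + 2 * pi * n"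
    using sin_cos_eq_iff[of x y] by (auto elim!: Ints_cases)
  then have "2 * pi * \<bar>real_of_int n\<bar> < 2 * pi * 1" using assms(2) by (simp add: abs_mult)
  then have "\<bar>real_of_int n\<bar> < 1" by (simp add: mult_less_cancel_left)
  then have "n = 0" by linarith
  then show ?thesis using n by simp
qed


lemma (in pl_pairs) point_pairs_at_end:
  assumes F: "F \<noteq> bot" "\<forall>\<^sub>F x in F. x \<in> {x1<..<x2}" "\<And>v. \<forall>\<^sub>F x in F. x \<noteq> v"
    and lim: "((\<lambda>x. \<tau>2 x - \<tau>1 x) \<longlongrightarrow> 0) F"
  shows "point_pairs F \<tau>1 \<tau>2"
proof
  show "F \<noteq> bot" by fact
  have generic: "\<forall>\<^sub>F x in F. poly p (cis (\<tau> x)) \<noteq> 0"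
    if p: "p \<noteq> 0" and inj: "inj_on \<tau> {x1<..<x2}"
      and range: "\<And>x. x \<in> {x1<..<x2} \<Longrightarrow> 0 < \<tau> x \<and> \<tau> x < 2 * pi"
    for p :: "complex poly" and \<tau> :: "real \<Rightarrow> real"
  proof -
    define Z where "Z = {x \<in> {x1<..<x2}. poly p (cis (\<tau> x)) = 0}"
    have "inj_on (\<lambda>x. cis (\<tau> x)) Z"
    proof (rule inj_onI)
      fix x y assume xy: "x \<in> Z" "y \<in> Z" "cis (\<tau> x) = cis (\<tau> y)"
      have "\<bar>\<tau> x - \<tau> y\<bar> < 2 * pi" using range[of x] range[of y] xy(1,2) by (auto simp: Z_def)
      from cis_eq_imp[OF xy(3) this] show "x = y"
        using inj_onD[OF inj, of x y] xy(1,2) by (simp add: Z_def)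
    qed
    moreover have "finite ((\<lambda>x. cis (\<tau> x)) ` Z)"
      by (rule finite_subset[OF _ poly_roots_finite[OF p]]) (auto simp: Z_def)
    ultimately have "finite Z" by (simp add: finite_image_iff)
    then have "\<forall>\<^sub>F x in F. \<forall>v\<in>Z. x \<noteq> v"
      by (rule eventually_ball_finite) (use F(3) in blast)
    then show ?thesis using F(2) by eventually_elim (auto simp: Z_def)
  qed
  show "\<forall>\<^sub>F x in F. poly p (cis (\<tau>1 x)) \<noteq> 0" "\<forall>\<^sub>F x in F. poly p (cis (\<tau>2 x)) \<noteq> 0"
    if "p \<noteq> 0" for p :: "complex poly"
    using generic[OF that inj_zeros(1)] generic[OF that inj_zeros(2)] zero_at by simp_all
  show "\<forall>\<^sub>F x in F. cis (\<tau>1 x) ^ e \<noteq> cis (\<tau>2 x) ^ e" if e: "0 < e" for e :: nat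
  proof -
    \<comment> \<open>The \<open>e\<close>-th powers have arguments differing by
      \<open>e * (\<tau>2 x - \<tau>1 x)\<close>, which then lies strictly between 0 and one full
      turn.\<close>
    have "\<forall>\<^sub>F x in F. \<tau>2 x - \<tau>1 x < 2 * pi / e"
      by (rule order_tendstoD(2)[OF lim]) (use e in simp)
    then show ?thesis using F(2)
    proof eventually_elim
      case (elim x)
      show ?case
      proof
        assume "cis (\<tau>1 x) ^ e = cis (\<tau>2 x) ^ e"
        then have "cis (real e * \<tau>2 x) = cis (real e * \<tau>1 x)" by (simp only: Complex.DeMoivre)
        moreover have pos: "0 < real e * (\<tau>2 x - \<tau>1 x)" using e less[OF elim(2)] by simp
        moreover have "real e * (\<tau>2 x - \<tau>1 x) < 2 * pi" using elim(1) e by (simp add: pos_less_divide_eq mult.commute)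
        ultimately have "real e * \<tau>2 x = real e * \<tau>1 x"
          by (intro cis_eq_imp) (simp_all add: right_diff_distrib)
        then show False using pos by auto
      qed
    qed
  qed
qed

lemma center_imp_composition:
  assumes a: "trig_degree_le n a" "\<exists>t. a t \<noteq> 0" and b: "trig_degree_le m b"
    and sol: "is_solution_map a b u" and center: "\<And>x. u (2 * pi) x = x"
    and pairs: "\<forall>x\<in>{x1<..<x2}.
        {t\<in>{0<..<2*pi}. u t x = 0} = {t1 x, t2 x} \<and> t1 x < t2 x \<and> b (t1 x) \<noteq> 0 \<and> b (t2 x) \<noteq> 0"
    and F: "F \<noteq> bot" "\<forall>\<^sub>F x in F. x \<in> {x1<..<x2}" "\<And>v. \<forall>\<^sub>F x in F. x \<noteq> v"
    and lim: "((\<lambda>x. t2 x - t1 x) \<longlongrightarrow> 0) F"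
  shows "\<exists>P Q h. trig_poly h \<and> (\<forall>t. a t = poly P (h t) * deriv h t \<and> b t = poly Q (h t) * deriv h t)"
proof -
  obtain K where K: "\<And>t. \<bar>a t\<bar> \<le> K" using trig_degree_le_bounded[OF a(1)] by blast
  obtain A0 \<kappa> where A0: "trig_degree_le n A0" "\<And>t. (A0 has_real_derivative a t - \<kappa>) (at t)"
    using trig_degree_le_antideriv[OF a(1)] by blast
  \<comment> \<open>The mean value \<kappa> of \<open>a\<close> gives a linear term; it vanishes
    only through \<open>periodic_A\<close>.\<close>
  define A where "A t = A0 t + \<kappa> * t" for t
  have dA: "(A has_real_derivative a t) (at t)" for t
    unfolding A_def using A0(2)[of t] by (auto intro!: derivative_eq_intros)
  have "\<forall>s. \<exists>G. \<forall>t. (G has_real_derivative b t * exp (- s * A t)) (at t)"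
  proof
    fix s
    have "isCont b t" "isCont A t" for t
      using trig_degree_le_continuous[OF b, of UNIV] DERIV_isCont[OF dA]
      by (simp_all add: continuous_on_eq_continuous_at)
    then show "\<exists>G. \<forall>t. (G has_real_derivative b t * exp (- s * A t)) (at t)"
      by (intro antiderivative_exists continuous_intros) auto
  qed
  from choice[OF this] obtain \<Phi> where
    \<Phi>: "\<And>s t. (\<Phi> s has_real_derivative b t * exp (- s * A t)) (at t)" by blast
  interpret pl_pairs a b A u \<Phi> K x1 x2 t1 t2
    using sol center pairs K dA \<Phi> unfolding is_solution_map_def
    by unfold_locales (simp_all add: pl_solution_def)
  have "\<kappa> = 0"
    using periodic_A trig_degree_le_periodic[OF A0(1), of 0] by (simp add: A_def)
  then have "A = A0" by (simp add: A_def fun_eq_iff)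
  with A0(1) have A: "trig_degree_le n A" by simp
  interpret point_pairs F t1 t2 by (rule point_pairs_at_end[OF F lim])
  \<comment> \<open>The relations at the zeros rest on the sign of \<open>x\<close>, so
    \<open>x = 0\<close> is left out.\<close>
  have ev: "\<forall>\<^sub>F x in F. x \<in> {x1<..<x2} \<and> x \<noteq> 0" using F(2) F(3)[of 0] by eventually_elim simp
  show ?thesis
  proof (rule composition[OF A dA _ a(2) b])
    show "invariant A" unfolding invariant_def
      using ev by eventually_elim (use pairs(1) in blast)
    show "\<forall>\<^sub>F x in F. a (t1 x) * b (t2 x) = a (t2 x) * b (t1 x)"
      using ev by eventually_elim (use pairs(2) in blast)
  qed
qed

theorem theorem1p2:
  fixes a b :: "real \<Rightarrow> real" and u :: "real \<Rightarrow> real \<Rightarrow> real"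
  assumes "trig_poly a" and "trig_poly b"
    and "\<And>t. b t = 0 \<Longrightarrow> deriv b t \<noteq> 0"
    and "is_solution_map a b u"
    and "\<exists>x1 x2 t1 t2. x1 < x2 \<and>
           (\<forall>x\<in>{x1<..<x2}.
              {t\<in>{0<..<2*pi}. u t x = 0} = {t1 x, t2 x} \<and> t1 x < t2 x \<and>
              b (t1 x) \<noteq> 0 \<and> b (t2 x) \<noteq> 0) \<and>
           (((\<lambda>x. t2 x - t1 x) \<longlongrightarrow> 0) (at_right x1) \<or>
            ((\<lambda>x. t2 x - t1 x) \<longlongrightarrow> 0) (at_left x2))"
  shows "(\<forall>x. u (2*pi) x = u 0 x) \<longleftrightarrow>
         (\<exists>(P::real poly) (Q::real poly) h. trig_poly h \<and>
            (\<forall>t. a t = poly P (h t) * deriv h t \<and> b t = poly Q (h t) * deriv h t))"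
proof
  obtain n where a: "trig_degree_le n a" using trig_poly_imp_degree_le[OF assms(1)] by blast
  obtain m where b: "trig_degree_le m b" using trig_poly_imp_degree_le[OF assms(2)] by blast
  have sol: "pl_solution a b (\<lambda>t. u t x)" and init: "u 0 x = x" for x
    using assms(4) unfolding is_solution_map_def pl_solution_def by blast+
  {
    assume "\<exists>P Q h. trig_poly h \<and>
      (\<forall>t. a t = poly P (h t) * deriv h t \<and> b t = poly Q (h t) * deriv h t)"
    then obtain P Q h where h: "trig_poly h" and PQ: "\<And>t. a t = poly P (h t) * deriv h t"
      "\<And>t. b t = poly Q (h t) * deriv h t" by blast
    obtain k where "trig_degree_le k h" using trig_poly_imp_degree_le[OF h] by blast
    from composition_imp_center[OF a this PQ sol] show "\<forall>x. u (2*pi) x = u 0 x" by blast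
  next
    assume per: "\<forall>x. u (2*pi) x = u 0 x"
    show "\<exists>P Q h. trig_poly h \<and>
      (\<forall>t. a t = poly P (h t) * deriv h t \<and> b t = poly Q (h t) * deriv h t)"
    proof (cases "\<exists>t. a t \<noteq> 0")
      case False
      \<comment> \<open>Here \<open>A\<close> is constant and yields no nonconstant invariant;
        instead \<open>h\<close> is a periodic antiderivative of \<open>b\<close>, with
        \<open>P = 0\<close> and \<open>Q = 1\<close>.\<close>
      then have a0: "a = (\<lambda>_. 0)" by auto
      obtain h where h: "trig_degree_le m h" "\<And>t. (h has_real_derivative b t) (at t)"
        using zero_coefficient_center[OF b sol[of 0, unfolded a0]] per by blast
      have "deriv h t = b t" for t using h(2) by (rule DERIV_imp_deriv)
      then show ?thesis
        using trig_degree_le_imp_trig_poly[OF h(1)] a0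
        by (intro exI[of _ 0] exI[of _ 1] exI[of _ h]) simp
    next
      case True
      from assms(5) obtain x1 x2 t1 t2 where x12: "x1 < x2" and
        pairs: "\<forall>x\<in>{x1<..<x2}. {t\<in>{0<..<2*pi}. u t x = 0} = {t1 x, t2 x} \<and> t1 x < t2 x \<and>
              b (t1 x) \<noteq> 0 \<and> b (t2 x) \<noteq> 0" and
        lim: "((\<lambda>x. t2 x - t1 x) \<longlongrightarrow> 0) (at_right x1) \<or> ((\<lambda>x. t2 x - t1 x) \<longlongrightarrow> 0) (at_left x2)"
        by blast
      have center: "u (2 * pi) x = x" for x using per init by simp
      note composition = center_imp_composition[OF a True b assms(4) center pairs]
      from lim show ?thesis
      proof
        assume "((\<lambda>x. t2 x - t1 x) \<longlongrightarrow> 0) (at_right x1)"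
        from composition[OF trivial_limit_at_right_real eventually_at_right_real[OF x12]
            eventually_neq_at_within this]
        show ?thesis .
      next
        assume "((\<lambda>x. t2 x - t1 x) \<longlongrightarrow> 0) (at_left x2)"
        from composition[OF trivial_limit_at_left_real eventually_at_left_real[OF x12]
            eventually_neq_at_within this]
        show ?thesis .
      qed
    qed
  }
qed

end
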